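(* Let $a,b,c$ be non-negative integers, not all zero, and let $s=a+b+c$. Then: (1) the number of $\mathrm{D}$-triangulations of $\Delta(a,b,c)$ is $\binom{s-1}{a-1}+\binom{s-1}{b-1}+\binom{s-1}{c-1}$; (2) the number of $\mathrm{T}$-triangulations of $\Delta(a,b,c)$ is $2^{s-1}-\sum_{\ell=0}^{a-1}\binom{s-1}{\ell}-\sum_{\ell=0}^{b-1}\binom{s-1}{\ell}-\sum_{\ell=0}^{c-1}\binom{s-1}{\ell}$; (3) the total number of triangulations of $\Delta(a,b,c)$ is $2^{s-1}-\sum_{\ell=0}^{a-2}\binom{s-1}{\ell}-\sum_{\ell=0}^{b-2}\binom{s-1}{\ell}-\sum_{\ell=0}^{c-2}\binom{s-1}{\ell}$.
   Context: $\Delta(a,b,c)$ is a triangle $ABC$ whose side $BC$ is subdivided by $a$ points, side $CA$ by $b$ points and side $AB$ by $c$ points (all lying on the respective sides); it is a planar point set of $a+b+c+3$ points. A triangulation is a maximal dissection of the triangle into triangles by non-crossing segments between these points (no point lies in the interior of a side of a triangle). In a triangulation $T$: an ear is a triangle of $T$ containing a corner $A$, $B$ or $C$; a central triangle is a triangle of $T$ whose three vertices are interior points of three different sides of $ABC$; a corner-side diagonal is a segment of $T$ joining a corner to an interior point of the opposite side. A $\mathrm{T}$-triangulation is one having a central triangle (equivalently three ears and no corner-side diagonal); a $\mathrm{D}$-triangulation is one having no central triangle (equivalently two ears and at least one corner-side diagonal). Conventions: $\binom{n}{m}=0$ for $m<0$, and empty sums are $0$. *)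

theory Defs
  imports "HOL-Analysis.Analysis"
begin

(* P is the planar point set of a triangle ABC with a, b, c extra points in the relative
   interiors of BC, CA, AB.  The positions on the sides are arbitrary. *)
definition subdivided_triangle ::
  "nat \<Rightarrow> nat \<Rightarrow> nat \<Rightarrow> real^2 \<Rightarrow> real^2 \<Rightarrow> real^2 \<Rightarrow> (real^2) set \<Rightarrow> bool" where
  "subdivided_triangle a b c A B C P \<longleftrightarrow>
     \<not> collinear {A, B, C} \<and>
     finite P \<and> {A, B, C} \<subseteq> P \<and>
     P \<subseteq> closed_segment B C \<union> closed_segment C A \<union> closed_segment A B \<and>
     card (P \<inter> open_segment B C) = a \<and>
     card (P \<inter> open_segment C A) = b \<and>
     card (P \<inter> open_segment A B) = c"

(* A triangulation is given by its set of (closed, nondegenerate) triangles.  The face-to-face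
   condition in the library predicate triangulation makes the dissecting segments non-crossing.
   The last clause, no point of P in the interior of a side of a triangle, is maximality:
   P lies on the boundary of ABC, so a further segment could be drawn only inside
   a triangle having a point of P in the interior of one of its sides. *)
definition triangulations ::
  "real^2 \<Rightarrow> real^2 \<Rightarrow> real^2 \<Rightarrow> (real^2) set \<Rightarrow> (real^2) set set set" where
  "triangulations A B C P =
     {\<T>. triangulation \<T> \<and>
          \<Union>\<T> = convex hull {A, B, C} \<and>
          (\<forall>T\<in>\<T>. 2 simplex T \<and>
             (\<forall>v. v extreme_point_of T \<longrightarrow> v \<in> P) \<and>
             (\<forall>v w. v extreme_point_of T \<and> w extreme_point_of T \<longrightarrow>
                P \<inter> open_segment v w = {}))}"

definition central_triangle ::
  "real^2 \<Rightarrow> real^2 \<Rightarrow> real^2 \<Rightarrow> (real^2) set \<Rightarrow> bool" where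
  "central_triangle A B C T \<longleftrightarrow>
     (\<exists>x \<in> open_segment B C. \<exists>y \<in> open_segment C A. \<exists>z \<in> open_segment A B.
        {v. v extreme_point_of T} = {x, y, z})"

definition T_triangulations ::
  "real^2 \<Rightarrow> real^2 \<Rightarrow> real^2 \<Rightarrow> (real^2) set \<Rightarrow> (real^2) set set set" where
  "T_triangulations A B C P =
     {\<T> \<in> triangulations A B C P. \<exists>T\<in>\<T>. central_triangle A B C T}"

definition D_triangulations ::
  "real^2 \<Rightarrow> real^2 \<Rightarrow> real^2 \<Rightarrow> (real^2) set \<Rightarrow> (real^2) set set set" where
  "D_triangulations A B C P =
     {\<T> \<in> triangulations A B C P. \<not> (\<exists>T\<in>\<T>. central_triangle A B C T)}"

(* Integer lower index, with value 0 when it is negative. *)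
definition binom :: "nat \<Rightarrow> int \<Rightarrow> int" where
  "binom n m = (if m < 0 then 0 else int (n choose nat m))"

end

theory Submission
  imports Defs
begin

text \<open>
  Number the points along the boundary from A = 0 to n.  In a triangulation of the sub-polygon with
  vertices i, ..., j, the edge ij lies in exactly one triangle ikj, and this triangle cuts the
  triangulation into triangulations of i, ..., k and k, ..., j.  So the numbers of triangulations
  satisfy the Catalan recursion, restricted to triangles without two vertices on one side unless they
  are neighbours; discarding the central triangles as well counts the D-triangulations.
  Around a corner the recursion is Pascal's rule.  For a chord from AB to CA it is Pascal's rule plus,
  if central triangles are allowed, a convolution of corner counts, which is a binomial coefficient
  with lower index a - 1.
\<close>

section \<open>Orientation in the plane\<close>

text \<open>The polygon on all points of \<open>P\<close> is only weakly convex: many triples of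
  vertices are collinear. What survives is that an edge between vertices on no common side has every
  other vertex strictly on one of its two sides, as decided by its number. All the geometry is drawn
  from these signs: triangles on different sides of such an edge meet in a common face, a triangle
  crossing the edge violates the face condition, and the edge cuts off exactly the hull of the
  vertices on one side. The closed formulas work because partial sums of a binomial row obey
  Pascal's rule as well. Moving one end of a chord lowers one upper limit; the limit
  \<open>a - 1\<close>, which belongs to BC, stays fixed, and the convolution makes up for exactly
  this defect. When the chord reaches B or C, two complementary partial sums add up to the power of
  2 and a single binomial coefficient remains. T-triangulations are not counted directly but as the
  difference of the other two numbers.\<close>

definition orient :: "real^2 \<Rightarrow> real^2 \<Rightarrow> real^2 \<Rightarrow> real" where
  "orient a b c = (b$1 - a$1) * (c$2 - a$2) - (b$2 - a$2) * (c$1 - a$1)"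

lemma orient_rotate: "orient b c a = orient a b c"
  by (simp add: orient_def algebra_simps)

lemma orient_swap: "orient a c b = - orient a b c"
  by (simp add: orient_def algebra_simps)

lemma orient_degenerate [simp]: "orient a a b = 0" "orient a b a = 0" "orient a b b = 0"
  by (simp_all add: orient_def)

text \<open>\<open>orient a b c\<close> is twice the signed area of the triangle, hence affine in
  its last argument; the weights add up to 1, so the constant term is carried along.\<close>

lemma orient_sum:
  assumes "sum u V = 1"
  shows "orient a b (\<Sum>x\<in>V. u x *\<^sub>R x) = (\<Sum>x\<in>V. u x * orient a b x)"
proof -
  have "orient a b (\<Sum>x\<in>V. u x *\<^sub>R x)
      = (b$1 - a$1) * ((\<Sum>x\<in>V. u x * x$2) - a$2 * sum u V)
      - (b$2 - a$2) * ((\<Sum>x\<in>V. u x * x$1) - a$1 * sum u V)"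
    by (simp add: orient_def assms)
  also have "\<dots> = (\<Sum>x\<in>V. u x * orient a b x)"
    unfolding orient_def sum_distrib_left sum_subtractf[symmetric]
    by (intro sum.cong refl) (simp add: algebra_simps)
  finally show ?thesis .
qed

lemma orient_comb2:
  assumes "s + t = 1"
  shows "orient a b (s *\<^sub>R x + t *\<^sub>R y) = s * orient a b x + t * orient a b y"
proof -
  have s: "s = 1 - t" using assms by simp
  show ?thesis by (simp add: orient_def s algebra_simps)
qed

lemma orient_comb3:
  assumes "s + t + u = 1"
  shows "orient a b (s *\<^sub>R x + t *\<^sub>R y + u *\<^sub>R z) = s * orient a b x + t * orient a b y + u * orient a b z"
proof -
  have s: "s = 1 - t - u" using assms by simp
  show ?thesis by (simp add: orient_def s algebra_simps)
qed

lemma orient_open_segment: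
  assumes "c \<in> open_segment a b"
  shows "orient a b c = 0"
proof -
  obtain t where "c = (1 - t) *\<^sub>R a + t *\<^sub>R b"
    using assms by (auto simp: in_segment)
  then show ?thesis using orient_comb2[of "1 - t" t] by simp
qed

lemma orient_eq_0_iff_collinear: "orient a b c = 0 \<longleftrightarrow> collinear {a, b, c}"
proof
  assume 0: "orient a b c = 0"
  show "collinear {a, b, c}"
  proof (cases "a = c")
    case False
    then consider "c$1 \<noteq> a$1" | "c$2 \<noteq> a$2"
      by (auto simp: vec_eq_iff forall_2)
    then have "\<exists>u. b = u *\<^sub>R a + (1 - u) *\<^sub>R c"
    proof cases
      case 1
      \<comment> \<open>The ratio is read off in a coordinate where \<open>a\<close> and
        \<open>c\<close> differ; the vanishing determinant says that it also fits the other
        coordinate.\<close>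
      define u where "u = (b$1 - c$1) / (a$1 - c$1)"
      have u: "u * (a$1 - c$1) = b$1 - c$1" using 1 by (simp add: u_def)
      have "(a$1 - c$1) * (b$2 - c$2) = (b$1 - c$1) * (a$2 - c$2)"
        using 0 by (simp add: orient_def algebra_simps)
      then have "(a$1 - c$1) * (b$2 - c$2) = (a$1 - c$1) * (u * (a$2 - c$2))"
        by (simp flip: u)
      then have "b$2 - c$2 = u * (a$2 - c$2)" using 1 by simp
      then show ?thesis
        using u by (intro exI[of _ u]) (simp add: vec_eq_iff forall_2 algebra_simps)
    next
      case 2
      define u where "u = (b$2 - c$2) / (a$2 - c$2)"
      have u: "u * (a$2 - c$2) = b$2 - c$2" using 2 by (simp add: u_def)
      have "(a$2 - c$2) * (b$1 - c$1) = (b$2 - c$2) * (a$1 - c$1)"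
        using 0 by (simp add: orient_def algebra_simps)
      then have "(a$2 - c$2) * (b$1 - c$1) = (a$2 - c$2) * (u * (a$1 - c$1))"
        by (simp flip: u)
      then have "b$1 - c$1 = u * (a$1 - c$1)" using 2 by simp
      then show ?thesis
        using u by (intro exI[of _ u]) (simp add: vec_eq_iff forall_2 algebra_simps)
    qed
    then show ?thesis unfolding collinear_3_expand by blast
  qed (simp add: insert_commute)
next
  assume "collinear {a, b, c}"
  then consider "a = c" | u where "b = u *\<^sub>R a + (1 - u) *\<^sub>R c"
    unfolding collinear_3_expand by blast
  then show "orient a b c = 0"
  proof cases
    case (2 u)
    show ?thesis by (simp add: 2 orient_def algebra_simps)
  qed simp
qed

lemma orient_nonzero_distinct:
  assumes "orient a b c \<noteq> 0"
  shows "a \<noteq> b" "a \<noteq> c" "b \<noteq> c"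
  using assms by auto

lemma affine_independent_orient:
  assumes "orient a b c \<noteq> 0"
  shows "\<not> affine_dependent {a, b, c}"
  using assms orient_eq_0_iff_collinear collinear_3_eq_affine_dependent by blast

section \<open>Triangles and convex hulls through signs of orientations\<close>

text \<open>Barycentric coordinates are quotients of signed areas: the three orientations at
  \<open>x\<close> add up to that of the triangle, so after division they are convex
  weights.\<close>

lemma in_triangle_orient:
  assumes o: "0 < \<sigma> * orient a b c"
    and "0 \<le> \<sigma> * orient a b x" "0 \<le> \<sigma> * orient b c x" "0 \<le> \<sigma> * orient c a x"
  shows "x \<in> convex hull {a, b, c}"
proof -
  define d where "d = \<sigma> * orient a b c"
  have d: "d > 0" using o d_def by simp
  define u where "u = \<sigma> * orient b c x / d"
  define v where "v = \<sigma> * orient c a x / d"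
  define w where "w = \<sigma> * orient a b x / d"
  have "\<sigma> * orient b c x + \<sigma> * orient c a x + \<sigma> * orient a b x = d"
    unfolding d_def orient_def by (simp add: algebra_simps)
  then have "u + v + w = 1"
    unfolding u_def v_def w_def using d by (simp add: add_divide_distrib[symmetric])
  moreover have "u \<ge> 0" "v \<ge> 0" "w \<ge> 0"
    using assms d by (simp_all add: u_def v_def w_def)
  moreover have "x = u *\<^sub>R a + v *\<^sub>R b + w *\<^sub>R c"
  proof -
    have "d * (x$i) = (d * u) * a$i + (d * v) * b$i + (d * w) * c$i" if "i = 1 \<or> i = 2" for i
      using that d by (auto simp: u_def v_def w_def) (auto simp: d_def orient_def algebra_simps)
    then have "d * (x$i) = d * (u * a$i + v * b$i + w * c$i)" if "i = 1 \<or> i = 2" for i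
      using that by (simp add: algebra_simps)
    then show ?thesis using d by (simp add: vec_eq_iff forall_2)
  qed
  ultimately show ?thesis unfolding convex_hull_3 by blast
qed

lemma convex_orient_nonneg: "convex {x. 0 \<le> \<sigma> * orient a b x}"
  unfolding convex_def
proof (clarsimp)
  fix x y :: "real^2" and s t :: real
  assume "0 \<le> \<sigma> * orient a b x" "0 \<le> \<sigma> * orient a b y" "0 \<le> s" "0 \<le> t" "s + t = 1"
  then have "0 \<le> s * (\<sigma> * orient a b x) + t * (\<sigma> * orient a b y)" by simp
  also have "\<dots> = \<sigma> * orient a b (s *\<^sub>R x + t *\<^sub>R y)"
    by (simp add: orient_comb2 \<open>s + t = 1\<close> distrib_left mult.left_commute)
  finally show "0 \<le> \<sigma> * orient a b (s *\<^sub>R x + t *\<^sub>R y)" .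
qed

lemma orient_nonneg_hull:
  assumes "\<And>x. x \<in> S \<Longrightarrow> 0 \<le> \<sigma> * orient a b x" "y \<in> convex hull S"
  shows "0 \<le> \<sigma> * orient a b y"
  using hull_minimal[of S "{x. 0 \<le> \<sigma> * orient a b x}" convex] convex_orient_nonneg assms by blast

lemma orient_nonpos_hull:
  assumes "\<And>x. x \<in> S \<Longrightarrow> \<sigma> * orient a b x \<le> 0" "y \<in> convex hull S"
  shows "\<sigma> * orient a b y \<le> 0"
  using orient_nonneg_hull[of S "- \<sigma>" a b y] assms by simp

text \<open>The line supports the hull. A convex combination on it is a vanishing sum of nonnegative
  terms, so vertices off the line have weight 0.\<close>

lemma hull_inter_line:
  assumes "finite V" "\<And>x. x \<in> V \<Longrightarrow> 0 \<le> \<sigma> * orient a b x"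
    and y: "y \<in> convex hull V" "\<sigma> * orient a b y = 0"
  shows "y \<in> convex hull {x \<in> V. \<sigma> * orient a b x = 0}"
proof -
  obtain u where u: "\<And>x. x \<in> V \<Longrightarrow> 0 \<le> u x" "sum u V = 1" "(\<Sum>x\<in>V. u x *\<^sub>R x) = y"
    using y(1) unfolding convex_hull_finite[OF assms(1)] by blast
  let ?Z = "{x \<in> V. \<sigma> * orient a b x = 0}"
  have "(\<Sum>x\<in>V. u x * (\<sigma> * orient a b x)) = \<sigma> * orient a b y"
    using orient_sum[OF u(2), of a b] u(3) by (simp add: sum_distrib_left mult.left_commute)
  then have "(\<Sum>x\<in>V. u x * (\<sigma> * orient a b x)) = 0" using y(2) by simp
  moreover have "\<And>x. x \<in> V \<Longrightarrow> 0 \<le> u x * (\<sigma> * orient a b x)"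
    using assms(2) u(1) by simp
  ultimately have "\<And>x. x \<in> V \<Longrightarrow> u x * (\<sigma> * orient a b x) = 0"
    using sum_nonneg_eq_0_iff[OF assms(1), of "\<lambda>x. u x * (\<sigma> * orient a b x)"] by blast
  then have z: "\<And>x. x \<in> V - ?Z \<Longrightarrow> u x = 0" by fastforce
  have "sum u ?Z = 1" "(\<Sum>x\<in>?Z. u x *\<^sub>R x) = y"
    using u(2,3) sum.mono_neutral_left[of V ?Z u] sum.mono_neutral_left[of V ?Z "\<lambda>x. u x *\<^sub>R x"]
      z assms(1) by auto
  then show ?thesis
    using u(1) assms(1) by (subst convex_hull_finite) (auto intro!: exI[of _ u])
qed

text \<open>The intersection can only lie on the separating line, where each hull is spanned by its
  own vertices on the line. These all belong to the independent set \<open>K\<close>, so the two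
  hulls meet in the hull of their common vertices, a face of both.\<close>

lemma opposite_sides_face:
  assumes V: "\<not> affine_dependent V" "\<And>x. x \<in> V \<Longrightarrow> \<sigma> * orient a b x \<le> 0"
    and W: "\<not> affine_dependent W" "\<And>x. x \<in> W \<Longrightarrow> 0 \<le> \<sigma> * orient a b x"
    and K: "\<not> affine_dependent K"
      "\<And>x. x \<in> V \<union> W \<Longrightarrow> \<sigma> * orient a b x = 0 \<Longrightarrow> x \<in> K"
  shows "(convex hull V \<inter> convex hull W) face_of convex hull V"
    and "(convex hull W \<inter> convex hull V) face_of convex hull W"
proof -
  let ?V = "{x \<in> V. \<sigma> * orient a b x = 0}" and ?W = "{x \<in> W. \<sigma> * orient a b x = 0}"
  have fin: "finite V" "finite W" using V(1) W(1) aff_independent_finite by auto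
  have indep: "\<not> affine_dependent (?V \<union> ?W)"
    by (rule affine_independent_subset[OF K(1)]) (use K(2) in auto)
  have "y \<in> convex hull (?V \<inter> ?W)" if y: "y \<in> convex hull V" "y \<in> convex hull W" for y
  proof -
    have "\<sigma> * orient a b y \<le> 0" by (rule orient_nonpos_hull[OF V(2) y(1)])
    moreover have "0 \<le> \<sigma> * orient a b y" by (rule orient_nonneg_hull[OF W(2) y(2)])
    ultimately have y0: "\<sigma> * orient a b y = 0" by simp
    have "y \<in> convex hull ?W" by (rule hull_inter_line[OF fin(2) W(2) y(2) y0])
    moreover have "0 \<le> - \<sigma> * orient a b x" if "x \<in> V" for x using V(2)[OF that] by simp
    then have "y \<in> convex hull {x \<in> V. - \<sigma> * orient a b x = 0}"
      by (rule hull_inter_line[OF fin(1) _ y(1)]) (use y0 in simp_all)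
    then have "y \<in> convex hull ?V" by simp
    ultimately show ?thesis using convex_hull_Int[OF indep] by simp
  qed
  moreover have "convex hull (?V \<inter> ?W) \<subseteq> convex hull V" "convex hull (?V \<inter> ?W) \<subseteq> convex hull W"
    by (auto intro!: hull_mono)
  ultimately have *: "convex hull V \<inter> convex hull W = convex hull (?V \<inter> ?W)" by blast
  show "(convex hull V \<inter> convex hull W) face_of convex hull V"
    unfolding * face_of_convex_hull_affine_independent[OF V(1)]
    by (intro exI[of _ "?V \<inter> ?W"]) auto
  have *: "convex hull W \<inter> convex hull V = convex hull (?V \<inter> ?W)" using * by blast
  show "(convex hull W \<inter> convex hull V) face_of convex hull W"
    unfolding * face_of_convex_hull_affine_independent[OF W(1)]
    by (intro exI[of _ "?V \<inter> ?W"]) auto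
qed

section \<open>Dissections of degenerate convex polygons\<close>

text \<open>A polygon with vertices \<open>v 0, \<dots>, v n\<close> in cyclic order, in which several vertices may lie on
  one side.  The relation \<open>E\<close> holds for neighbours and for vertices on no common side.  The factor \<open>\<sigma>\<close>
  absorbs the orientation.\<close>

locale polygon =
  fixes n :: nat and v :: "nat \<Rightarrow> real^2" and E :: "nat \<Rightarrow> nat \<Rightarrow> bool" and \<sigma> :: real
  assumes weak: "\<lbrakk>i < j; j < k; k \<le> n\<rbrakk> \<Longrightarrow> 0 \<le> \<sigma> * orient (v i) (v j) (v k)"
    and strict_inside: "\<lbrakk>E x y; x < q; q < y; y \<le> n\<rbrakk> \<Longrightarrow> 0 < \<sigma> * orient (v x) (v q) (v y)"
    and strict_before: "\<lbrakk>E x y; Suc x < y; y \<le> n; q < x\<rbrakk> \<Longrightarrow> 0 < \<sigma> * orient (v q) (v x) (v y)"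
    and strict_after: "\<lbrakk>E x y; Suc x < y; y < q; q \<le> n\<rbrakk> \<Longrightarrow> 0 < \<sigma> * orient (v x) (v y) (v q)"
    and strict_start: "0 < \<sigma> * orient (v 0) (v 1) (v n)"
begin

text \<open>A scaled signed distance from the line through two vertices. For \<open>x < y\<close>,
  vertices numbered from \<open>x\<close> to \<open>y\<close> have values \<open>\<le> 0\<close> and
  the others values \<open>\<ge> 0\<close>.\<close>

definition side :: "nat \<Rightarrow> nat \<Rightarrow> real^2 \<Rightarrow> real" where
  "side x y z = \<sigma> * orient (v x) (v y) z"

text \<open>The closing edge from \<open>v 0\<close> to \<open>v n\<close> is separate because it may be collinear with further
  vertices between 0 and n, so the strictness axioms can fail for it.\<close>

definition base :: "nat \<Rightarrow> nat \<Rightarrow> bool" where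
  "base i j \<longleftrightarrow> i < j \<and> j \<le> n \<and> (E i j \<or> i = 0 \<and> j = n)"

text \<open>Only the edge from \<open>p\<close> to \<open>r\<close> can be the closing edge, because
  \<open>p < q < r\<close>; so \<open>E\<close> is demanded of the other two and the weaker
  \<open>base\<close> of this one.\<close>

definition admissible :: "nat \<times> nat \<times> nat \<Rightarrow> bool" where
  "admissible t = (case t of (p, q, r) \<Rightarrow> p < q \<and> q < r \<and> r \<le> n \<and> E p q \<and> E q r \<and> base p r)"

definition tri :: "nat \<times> nat \<times> nat \<Rightarrow> (real^2) set" where
  "tri t = (case t of (p, q, r) \<Rightarrow> convex hull {v p, v q, v r})"

text \<open>A single edge is the empty polygon, with the empty dissection.\<close>

definition region :: "nat \<Rightarrow> nat \<Rightarrow> (real^2) set" where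
  "region i j = (if j = Suc i then {} else convex hull (v ` {i..j}))"

text \<open>The filter \<open>F\<close> lets one recursion count both all triangulations and those
  without a central triangle.\<close>

definition triples :: "(nat \<times> nat \<times> nat \<Rightarrow> bool) \<Rightarrow> nat \<Rightarrow> nat \<Rightarrow> (nat \<times> nat \<times> nat) set" where
  "triples F i j = {(p, q, r). i \<le> p \<and> r \<le> j \<and> admissible (p, q, r) \<and> F (p, q, r)}"

definition dissections :: "(nat \<times> nat \<times> nat \<Rightarrow> bool) \<Rightarrow> nat \<Rightarrow> nat \<Rightarrow> (nat \<times> nat \<times> nat) set set" where
  "dissections F i j = {S. S \<subseteq> triples F i j \<and> (\<forall>s\<in>S. \<forall>t\<in>S. (tri s \<inter> tri t) face_of tri s)
     \<and> \<Union>(tri ` S) = region i j}"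

section \<open>Signs of vertices against edges\<close>

lemma side_rotate: "side y z (v x) = side x y (v z)"
  unfolding side_def using orient_rotate[of "v y" "v z" "v x"] by simp

lemma side_swap: "side x z (v y) = - side x y (v z)"
  unfolding side_def using orient_swap[of "v x" "v z" "v y"] by simp

lemma side_end [simp]: "side x y (v x) = 0" "side x y (v y) = 0"
  unfolding side_def by simp_all

lemma side_comb2:
  assumes "s + t = 1"
  shows "side x y (s *\<^sub>R z + t *\<^sub>R w) = s * side x y z + t * side x y w"
  unfolding side_def orient_comb2[OF assms] by (simp add: algebra_simps)

lemma side_comb3:
  assumes "s + t + u = 1"
  shows "side x y (s *\<^sub>R z + t *\<^sub>R w + u *\<^sub>R w') = s * side x y z + t * side x y w + u * side x y w'"
  unfolding side_def orient_comb3[OF assms] by (simp add: algebra_simps)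

lemma side_inside_nonpos:
  assumes "x \<le> q" "q \<le> y" "y \<le> n"
  shows "side x y (v q) \<le> 0"
proof (cases "x = q \<or> q = y")
  case False
  then have "0 \<le> side x q (v y)" using weak[of x q y] assms by (simp add: side_def)
  then show ?thesis using side_swap[of x q y] by simp
qed auto

lemma side_outside_nonneg:
  assumes "x < y" "y \<le> n" "q \<le> n" "q \<le> x \<or> y \<le> q"
  shows "0 \<le> side x y (v q)"
proof -
  consider "q = x \<or> q = y" | "q < x" | "y < q" using assms by linarith
  then show ?thesis
  proof cases
    case 2
    then have "0 \<le> side q x (v y)" using weak[of q x y] assms by (simp add: side_def)
    then show ?thesis by (simp add: side_rotate)
  next
    case 3
    then show ?thesis using weak[of x y q] assms by (simp add: side_def)
  qed auto
qed

lemma side_inside_neg: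
  assumes "E x y" "x < q" "q < y" "y \<le> n"
  shows "side x y (v q) < 0"
proof -
  have "0 < side x q (v y)" using strict_inside[of x y q] assms by (simp add: side_def)
  then show ?thesis using side_swap[of x q y] by simp
qed

lemma side_outside_pos:
  assumes "E x y" "Suc x < y" "y \<le> n" "q \<le> n" "q < x \<or> y < q"
  shows "0 < side x y (v q)"
  using assms(5)
proof
  assume "q < x"
  then have "0 < side q x (v y)" using strict_before[of x y q] assms by (simp add: side_def)
  then show ?thesis by (simp add: side_rotate)
next
  assume "y < q"
  then show ?thesis using strict_after[of x y q] assms by (simp add: side_def)
qed

lemma admissible_pos:
  assumes "admissible (p, q, r)"
  shows "0 < side p q (v r)"
proof -
  have a: "p < q" "q < r" "r \<le> n" "E p q" "E q r" "E p r \<or> p = 0 \<and> r = n"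
    using assms by (auto simp: admissible_def base_def)
  show ?thesis
  proof (cases "E p r")
    case True then show ?thesis using a strict_inside[of p r q] by (simp add: side_def)
  next
    case False
    then have "p = 0" "r = n" using a by auto
    then show ?thesis
      using strict_start a strict_after[of 0 q n] by (cases "q = 1") (auto simp: side_def)
  qed
qed

lemma tri_indep:
  assumes "admissible (p, q, r)"
  shows "\<not> affine_dependent {v p, v q, v r}"
proof (rule affine_independent_orient)
  show "orient (v p) (v q) (v r) \<noteq> 0" using admissible_pos[OF assms] by (auto simp: side_def)
qed

lemma triples_finite: "finite (triples F i j)"
proof (rule finite_subset)
  show "triples F i j \<subseteq> {..n} \<times> {..n} \<times> {..n}"
    by (auto simp: triples_def admissible_def)
qed auto

lemma dissections_finite: "finite (dissections F i j)"
  by (rule finite_subset[of _ "Pow (triples F i j)"]) (auto simp: dissections_def triples_finite)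

lemma dissections_Suc: "dissections F i (Suc i) = {{}}"
proof -
  have "triples F i (Suc i) = {}" by (auto simp: triples_def admissible_def)
  then show ?thesis by (auto simp: dissections_def region_def)
qed

lemma tri_subset_hull:
  assumes "i \<le> p" "p < q" "q < r" "r \<le> j"
  shows "tri (p, q, r) \<subseteq> convex hull (v ` {i..j})"
  unfolding tri_def using assms by (auto intro!: hull_mono)

lemma hull_subset_all: "j \<le> n \<Longrightarrow> convex hull (v ` {i..j}) \<subseteq> convex hull (v ` {..n})"
  by (intro hull_mono image_mono) auto

lemma tri_side_nonneg:
  assumes "\<And>m. m \<in> {p, q, r} \<Longrightarrow> 0 \<le> side x y (v m)" "w \<in> tri (p, q, r)"
  shows "0 \<le> side x y w"
  using orient_nonneg_hull[of "{v p, v q, v r}" \<sigma> "v x" "v y" w] assms unfolding tri_def side_def by auto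

lemma hull_side_nonneg:
  assumes "\<And>m. m \<in> I \<Longrightarrow> 0 \<le> side x y (v m)" "w \<in> convex hull (v ` I)"
  shows "0 \<le> side x y w"
  using orient_nonneg_hull[of "v ` I" \<sigma> "v x" "v y" w] assms unfolding side_def by auto

lemma hull_side_nonpos:
  assumes "\<And>m. m \<in> I \<Longrightarrow> side x y (v m) \<le> 0" "w \<in> convex hull (v ` I)"
  shows "side x y w \<le> 0"
  using orient_nonpos_hull[of "v ` I" \<sigma> "v x" "v y" w] assms unfolding side_def by auto

section \<open>Chords as cuts of the polygon\<close>

text \<open>On the line of the chord, the boundary edges next to its ends stop the polygon: the edge
  after \<open>x\<close> forbids passing \<open>v x\<close>, the edge before \<open>y\<close>
  forbids passing \<open>v y\<close>.\<close>

lemma chord_inter_hull: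
  assumes c: "E x y" "Suc x < y" "y \<le> n"
    and w: "w \<in> convex hull (v ` {..n})" "side x y w = 0"
  shows "w \<in> closed_segment (v x) (v y)"
proof -
  have neg: "side x y (v (Suc x)) < 0" using side_inside_neg[of x y "Suc x"] c by simp
  have neg': "side x y (v (y - 1)) < 0" using side_inside_neg[of x y "y - 1"] c by simp
  have ne: "v x \<noteq> v y" using neg unfolding side_def by auto
  have "orient (v x) (v y) w = 0" using w(2) neg unfolding side_def by auto
  then have "collinear {v x, w, v y}" using orient_eq_0_iff_collinear insert_commute by metis
  then obtain u where u: "w = u *\<^sub>R v x + (1 - u) *\<^sub>R v y"
    using ne unfolding collinear_3_expand by auto
  have "0 \<le> side x (Suc x) w"
    by (rule hull_side_nonneg[OF side_outside_nonneg w(1)]) (use c in auto)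
  also have "side x (Suc x) w = (1 - u) * side x (Suc x) (v y)"
    unfolding u by (subst side_comb2) auto
  finally have "0 \<le> (1 - u) * side x (Suc x) (v y)" .
  moreover have "side x (Suc x) (v y) > 0"
    using neg side_swap[of x y "Suc x"] by simp
  ultimately have 1: "u \<le> 1" by (simp add: zero_le_mult_iff)
  have "0 \<le> side (y - 1) y w"
    by (rule hull_side_nonneg[OF side_outside_nonneg w(1)]) (use c in auto)
  also have "side (y - 1) y w = u * side (y - 1) y (v x)"
    unfolding u by (subst side_comb2) auto
  finally have "0 \<le> u * side (y - 1) y (v x)" .
  moreover have "side (y - 1) y (v x) > 0"
    using neg' side_swap[of x y "y - 1"] side_rotate[of "y - 1" y x] by simp
  ultimately have 2: "0 \<le> u" by (simp add: zero_le_mult_iff)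
  show ?thesis using 1 2 u unfolding closed_segment_def
    by (intro CollectI exI[of _ "1 - u"]) auto
qed

text \<open>A point beyond the chord lies on a segment from the part cut off to the rest of the
  polygon. That segment meets the chord, and the point lies between its first end and this crossing,
  both in the hull of the part.\<close>

lemma hull_split:
  assumes c: "E x y" "Suc x < y" "i \<le> x" "y \<le> j" "j \<le> n"
    and w: "w \<in> convex hull (v ` {i..j})" "side x y w \<le> 0"
  shows "w \<in> convex hull (v ` {x..y})"
proof -
  have seg: "z \<in> convex hull (v ` {x..y})" if "z \<in> convex hull (v ` {i..j})" "side x y z = 0" for z
  proof -
    have "z \<in> convex hull (v ` {..n})"
      using that(1) hull_subset_all c by blast
    then have "z \<in> closed_segment (v x) (v y)"
      using chord_inter_hull[of x y z] c that(2) by simp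
    also have "\<dots> \<subseteq> convex hull (v ` {x..y})"
      unfolding segment_convex_hull using c by (intro hull_mono) auto
    finally show ?thesis .
  qed
  show ?thesis
  proof (cases "side x y w = 0")
    case False
    let ?Q = "v ` {x..y}" and ?K = "v ` ({i..x} \<union> {y..j})"
    have "{i..j} = {x..y} \<union> ({i..x} \<union> {y..j})" using c by auto
    then have "v ` {i..j} = ?Q \<union> ?K" by (metis image_Un)
    then have "w \<in> convex hull (?Q \<union> ?K)" using w(1) by simp
    also have "\<dots> = convex hull (convex hull ?Q \<union> convex hull ?K)" by (rule hull_Un) (simp add: convex_Inter)
    also have "\<dots> = {s *\<^sub>R y + t *\<^sub>R z | s t y z. s \<ge> 0 \<and> t \<ge> 0 \<and> s + t = 1 \<and> y \<in> convex hull ?Q \<and> z \<in> convex hull ?K}"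
      by (rule convex_hull_union_two) (use c in auto)
    finally obtain s t y1 z1 where st: "s \<ge> 0" "t \<ge> 0" "s + t = 1"
      and y1: "y1 \<in> convex hull ?Q" and z1: "z1 \<in> convex hull ?K"
      and w': "w = s *\<^sub>R y1 + t *\<^sub>R z1"
      by blast
    define h g where "h = side x y y1" and "g = side x y z1"
    have g: "0 \<le> g" unfolding g_def
      by (rule hull_side_nonneg[OF side_outside_nonneg z1]) (use c in auto)
    have "side x y w = s * h + t * g"
      unfolding w' side_comb2[OF st(3)] g_def h_def ..
    then have neg: "s * h + t * g < 0" using False w(2) by simp
    moreover have "0 \<le> t * g" using st g by simp
    ultimately have "s * h < 0" by simp
    then have h: "h < 0" using st by (simp add: mult_less_0_iff)
    \<comment> \<open>The weight at which the affine function between \<open>h < 0\<close> and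
      \<open>g \<ge> 0\<close> vanishes; \<open>w0\<close> is the crossing with the chord.\<close>
    define l where "l = g / (g - h)"
    have l: "0 \<le> l" "l < 1" using g h unfolding l_def by auto
    define w0 where "w0 = l *\<^sub>R y1 + (1 - l) *\<^sub>R z1"
    have "side x y w0 = l * h + (1 - l) * g"
      unfolding w0_def h_def g_def by (subst side_comb2) auto
    also have "\<dots> = 0" using g h unfolding l_def by (simp add: field_simps)
    finally have w00: "side x y w0 = 0" .
    have sub: "y1 \<in> convex hull (v ` {i..j})" "z1 \<in> convex hull (v ` {i..j})"
      using y1 z1 hull_mono[of ?Q "v ` {i..j}"] hull_mono[of ?K "v ` {i..j}"] c by fastforce+
    have "w0 \<in> convex hull (v ` {i..j})"
      unfolding w0_def using sub l by (intro convexD[OF convex_convex_hull]) auto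
    then have w0: "w0 \<in> convex hull ?Q" using seg w00 by simp
    have s: "s = 1 - t" using st by simp
    have "t * (g - h) < - h" using neg unfolding s by (simp add: algebra_simps)
    then have "t < (- h) / (g - h)" using g h by (subst pos_less_divide_eq) auto
    also have "\<dots> = 1 - l" using g h unfolding l_def by (simp add: field_simps)
    finally have tl: "t < 1 - l" .
    \<comment> \<open>The weight of \<open>w0\<close> when \<open>w\<close> is rewritten as a
      combination of \<open>w0\<close> and \<open>y1\<close>.\<close>
    define m where "m = t / (1 - l)"
    have m: "0 \<le> m" "m \<le> 1" using tl l st unfolding m_def by auto
    have mt: "m * (1 - l) = t" using l unfolding m_def by simp
    have "m *\<^sub>R w0 + (1 - m) *\<^sub>R y1 = (m * (1 - l)) *\<^sub>R z1 + (1 - m * (1 - l)) *\<^sub>R y1"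
      unfolding w0_def by (simp add: algebra_simps)
    also have "\<dots> = w" unfolding mt w' s by simp
    finally have "w = m *\<^sub>R w0 + (1 - m) *\<^sub>R y1" by simp
    then show ?thesis using w0 y1 m convexD[OF convex_convex_hull, of w0 ?Q y1 m "1 - m"] by simp
  qed (use seg w in auto)
qed

lemma tri_triples_subset_hull:
  assumes "t \<in> triples F i j"
  shows "tri t \<subseteq> convex hull (v ` {i..j})"
proof -
  obtain p q r where t: "t = (p, q, r)" by (cases t)
  then show ?thesis
    using assms tri_subset_hull[of i p q r j] by (simp add: triples_def admissible_def)
qed

text \<open>The edge from \<open>v a\<close> to \<open>v b\<close> meets the chord in an inner point
  of the edge, which lies in both sets. A face containing an inner point of a segment contains its
  ends.\<close>

lemma no_crossing:
  assumes face: "(tri t \<inter> T) face_of tri t"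
    and t: "t = (p, q, r)" "p < q" "q < r" "r \<le> n" and ab: "a \<in> {p, q, r}" "b \<in> {p, q, r}"
    and s: "side x y (v a) < 0" "0 < side x y (v b)"
    and c: "E x y" "Suc x < y" "y \<le> n" and T: "closed_segment (v x) (v y) \<subseteq> T"
  shows "v a \<in> T"
proof -
  have sub: "tri t \<subseteq> convex hull (v ` {..n})"
    using tri_subset_hull[of 0 p q r n] t by (simp add: atMost_atLeast0)
  have in_tri: "v a \<in> tri t" "v b \<in> tri t"
    using ab hull_subset[of "{v p, v q, v r}" convex] unfolding tri_def t(1) by auto
  define f g where "f = side x y (v a)" and "g = side x y (v b)"
  have fg: "f < 0" "0 < g" using s unfolding f_def g_def by auto
  define l where "l = f / (f - g)"
  have l: "0 < l" "l < 1" using fg unfolding l_def by (auto simp: zero_less_divide_iff divide_less_eq)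
  define w where "w = (1 - l) *\<^sub>R v a + l *\<^sub>R v b"
  have "side x y w = (1 - l) * f + l * g"
    unfolding w_def f_def g_def by (subst side_comb2) auto
  also have "\<dots> = 0" using fg unfolding l_def by (simp add: field_simps)
  finally have w0: "side x y w = 0" .
  have "v a \<noteq> v b" using s by auto
  then have w_open: "w \<in> open_segment (v a) (v b)"
    unfolding in_segment w_def using l by blast
  have "convex (tri t)" unfolding tri_def by (simp add: t)
  then have wt: "w \<in> tri t"
    unfolding w_def using in_tri l by (intro convexD) auto
  then have "w \<in> T" using chord_inter_hull[OF c] sub w0 T by blast
  then have "v a \<in> tri t \<inter> T"
    using face wt w_open in_tri unfolding face_of_def by blast
  then show ?thesis by simp
qed

section \<open>Cutting a dissection at the triangle on its base\<close>

text \<open>A triangle straddling \<open>k\<close> has an edge that crosses one of the two inner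
  edges of the base triangle. By \<open>no_crossing\<close> the end of it in the outer part would
  belong to the base triangle, which lies on the opposite side of that inner edge.\<close>

lemma triangle_separates:
  assumes S: "S \<in> dissections F i j" and t0: "(i, k, j) \<in> S" and t: "(p, q, r) \<in> S"
    and ne: "(p, q, r) \<noteq> (i, k, j)"
  shows "r \<le> k \<or> k \<le> p"
proof (rule ccontr)
  assume "\<not> ?thesis"
  then have kp: "p < k" "k < r" by auto
  have a0: "i < k" "k < j" "j \<le> n" "E i k" "E k j"
    using S t0 by (auto simp: dissections_def triples_def admissible_def base_def)
  have a: "p < q" "q < r" "r \<le> j" "i \<le> p"
    using S t by (auto simp: dissections_def triples_def admissible_def)
  have face: "(tri (p, q, r) \<inter> tri (i, k, j)) face_of tri (p, q, r)"
    using S t t0 by (auto simp: dissections_def)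
  have seg: "closed_segment (v i) (v k) \<subseteq> tri (i, k, j)" "closed_segment (v k) (v j) \<subseteq> tri (i, k, j)"
    unfolding tri_def segment_convex_hull by (auto intro!: hull_mono)
  have t0i: "0 \<le> side i k w" and t0k: "0 \<le> side k j w" if "w \<in> tri (i, k, j)" for w
    by (rule tri_side_nonneg[OF side_outside_nonneg that]; use a0 in auto)+
  have left: False if ab: "a \<in> {p, q, r}" "b \<in> {p, q, r}" "i < a" "a < k" "k < b" for a b
  proof -
    have neg: "side i k (v a) < 0" using side_inside_neg[of i k a] a0 that by auto
    moreover have "0 < side i k (v b)" using side_outside_pos[of i k b] a0 a that by auto
    ultimately have "v a \<in> tri (i, k, j)"
      using no_crossing[OF face refl _ _ _ ab(1,2) _ _ _ _ _ seg(1)] a a0 that by auto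
    then show False using t0i neg by fastforce
  qed
  have right: False if ab: "a \<in> {p, q, r}" "b \<in> {p, q, r}" "b < k" "k < a" "a < j" for a b
  proof -
    have neg: "side k j (v a) < 0" using side_inside_neg[of k j a] a0 that by auto
    moreover have "0 < side k j (v b)" using side_outside_pos[of k j b] a0 a that by auto
    ultimately have "v a \<in> tri (i, k, j)"
      using no_crossing[OF face refl _ _ _ ab(1,2) _ _ _ _ _ seg(2)] a a0 that by auto
    then show False using t0k neg by fastforce
  qed
  \<comment> \<open>If both outer vertices agree with the base, the triangles differ in the middle
    vertex, and that vertex supplies the crossing.\<close>
  consider "i < p" | "r < j" | "p = i" "r = j" "q < k" | "p = i" "r = j" "k < q"
    using a kp ne by (metis le_neq_implies_less linorder_neqE_nat)
  then show False
  proof cases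
    case 1 then show False using left[of p r] kp by simp
  next
    case 2 then show False using right[of r p] kp by simp
  next
    case 3 then show False using left[of q r] kp a by simp
  next
    case 4 then show False using right[of q p] kp a by simp
  qed
qed

text \<open>Some triangle must cover the midpoint of the base, and a triangle that does so has both
  ends of the base as vertices.\<close>

lemma base_triangle:
  assumes S: "S \<in> dissections F i j" and b: "base i j" "Suc i < j"
  shows "\<exists>k. (i, k, j) \<in> S"
proof -
  have j: "j \<le> n" using b by (simp add: base_def)
  \<comment> \<open>\<open>E i y\<close> matters: when the base is the closing edge, further
    vertices may lie on its line.\<close>
  have neg: "side i j (v y) < 0" if y: "i < y" "y < j" "E i y" for y
  proof (cases "E i j")
    case True then show ?thesis using side_inside_neg y j by simp
  next
    case False
    then have ij: "i = 0" "j = n" using b by (auto simp: base_def)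
    have "0 < side 0 y (v n)"
    proof (cases "y = 1")
      case True then show ?thesis using strict_start by (simp add: side_def)
    next
      case False
      then show ?thesis using side_outside_pos[of 0 y n] y ij by auto
    qed
    then show ?thesis using side_swap[of 0 y n] ij by simp
  qed
  have pos: "0 < side (Suc i) j (v i)"
  proof (cases "E i j")
    case True
    then show ?thesis using side_inside_neg[of i j "Suc i"] b j side_swap[of i "Suc i" j]
      side_rotate[of "Suc i" j i] by simp
  next
    case False
    then have ij: "i = 0" "j = n" using b by (auto simp: base_def)
    then have "0 < side i (Suc i) (v j)" using strict_start by (simp add: side_def)
    then show ?thesis by (simp add: side_rotate)
  qed
  then have vij: "v i \<noteq> v j" by auto
  define m where "m = (1/2) *\<^sub>R v i + (1/2) *\<^sub>R v j"
  have "v i \<in> convex hull (v ` {i..j})" "v j \<in> convex hull (v ` {i..j})"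
    using b hull_subset[of "v ` {i..j}" convex] by auto
  then have "m \<in> convex hull (v ` {i..j})"
    unfolding m_def by (intro convexD[OF convex_convex_hull]) auto
  then have "m \<in> \<Union>(tri ` S)" using S b by (simp add: dissections_def region_def)
  then obtain p q r where t: "(p, q, r) \<in> S" "m \<in> tri (p, q, r)" by auto
  have a: "p < q" "q < r" "r \<le> j" "i \<le> p" "E p q" "base p r"
    using S t by (auto simp: dissections_def triples_def admissible_def)
  have m1: "side (Suc i) j m = 1/2 * side (Suc i) j (v i)"
    unfolding m_def by (subst side_comb2) auto
  have m0: "side i j m = 0"
    unfolding m_def by (subst side_comb2) auto
  have p: "p = i"
  proof (rule ccontr)
    assume "p \<noteq> i"
    then have "i < p" using a by simp
    have m: "m \<in> convex hull (v ` {p, q, r})" using t(2) unfolding tri_def by simp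
    \<comment> \<open>Without the vertex \<open>i\<close> the triangle lies behind the line through
      \<open>v (Suc i)\<close> and \<open>v j\<close>, while the midpoint is strictly in front of
      it.\<close>
    have "side (Suc i) j m \<le> 0"
      by (rule hull_side_nonpos[OF side_inside_nonpos m]) (use a j \<open>i < p\<close> in auto)
    then show False using m1 pos by simp
  qed
  have "r = j"
  proof (rule ccontr)
    assume "r \<noteq> j"
    then have rj: "r < j" "q < j" using a by auto
    \<comment> \<open>Since \<open>r < j \<le> n\<close>, the edge from \<open>i\<close> to
      \<open>r\<close> is not the closing edge. Both other vertices are then strictly below the base
      line, so the triangle meets this line only in \<open>v i\<close>, which is not the
      midpoint.\<close>
    then have "E i r" using a j p unfolding base_def by auto
    then have nr: "side i j (v r) < 0" using neg[of r] rj a p by simp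
    have nq: "side i j (v q) < 0" using neg[of q] rj a p by simp
    obtain u1 u2 u3 where u: "0 \<le> u1" "0 \<le> u2" "0 \<le> u3" "u1 + u2 + u3 = 1"
      "m = u1 *\<^sub>R v p + u2 *\<^sub>R v q + u3 *\<^sub>R v r"
      using t(2) unfolding tri_def convex_hull_3 by auto
    have "u2 * side i j (v q) + u3 * side i j (v r) = 0"
      using m0 unfolding u(5) side_comb3[OF u(4)] p by simp
    moreover have "u2 * side i j (v q) \<le> 0" "u3 * side i j (v r) \<le> 0"
      using u nq nr by (simp_all add: mult_nonneg_nonpos)
    ultimately have "u2 * side i j (v q) = 0" "u3 * side i j (v r) = 0" by linarith+
    then have "u2 = 0" "u3 = 0" using nq nr by auto
    then have "m = v i" using u p by simp
    moreover have "v j = 2 *\<^sub>R m - v i" unfolding m_def by (simp add: algebra_simps)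
    ultimately have "v j = v i" by (simp add: scaleR_2)
    then show False using vij by simp
  qed
  then show ?thesis using t p by auto
qed

text \<open>Strictly beyond the chord, the remaining triangles contain nothing, so those of the part
  must cover. Points on the chord itself are reached as limits, because a finite union of closed
  triangles is closed.\<close>

lemma cut_region:
  assumes S: "S \<in> dissections F i j" and c: "E x y" "x < y" "i \<le> x" "y \<le> j" "j \<le> n" "Suc i < j"
    and rest: "\<And>p q r m. \<lbrakk>(p, q, r) \<in> S; \<not> (x \<le> p \<and> r \<le> y); m \<in> {p, q, r}\<rbrakk> \<Longrightarrow> 0 \<le> side x y (v m)"
  shows "{(p, q, r) \<in> S. x \<le> p \<and> r \<le> y} \<in> dissections F x y"
proof -
  let ?S = "{(p, q, r) \<in> S. x \<le> p \<and> r \<le> y}"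
  have sub: "S \<subseteq> triples F i j" using S by (simp add: dissections_def)
  have St: "?S \<subseteq> triples F x y" using sub by (auto simp: triples_def)
  show ?thesis
  proof (cases "y = Suc x")
    case True
    have "t \<notin> ?S" for t
    proof
      assume "t \<in> ?S"
      then have "t \<in> triples F x y" using St by blast
      then show False using True by (auto simp: triples_def admissible_def)
    qed
    then have "?S = {}" by blast
    then show ?thesis using True by (simp add: dissections_Suc)
  next
    case False
    then have xy: "Suc x < y" using c by simp
    have fin: "finite ?S" using St triples_finite finite_subset by blast
    have cl: "closed (\<Union>(tri ` ?S))"
    proof (intro closed_UN fin ballI)
      fix t :: "nat \<times> nat \<times> nat"
      show "closed (tri t)"
        unfolding tri_def by (auto split: prod.split intro!: compact_imp_closed compact_convex_hull)
    qed
    have negin: "w \<in> \<Union>(tri ` ?S)" if w: "w \<in> convex hull (v ` {i..j})" "side x y w < 0" for w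
    proof -
      have "w \<in> \<Union>(tri ` S)" using S w c by (simp add: dissections_def region_def)
      then obtain p q r where t: "(p, q, r) \<in> S" "w \<in> tri (p, q, r)" by auto
      have "x \<le> p \<and> r \<le> y"
        using rest[OF t(1)] tri_side_nonneg[OF _ t(2), of x y] w(2) by fastforce
      then show ?thesis using t by auto
    qed
    have "\<Union>(tri ` ?S) = convex hull (v ` {x..y})"
    proof
      show "\<Union>(tri ` ?S) \<subseteq> convex hull (v ` {x..y})"
        by (rule UN_least, rule tri_triples_subset_hull, rule subsetD[OF St])
    next
      show "convex hull (v ` {x..y}) \<subseteq> \<Union>(tri ` ?S)"
      proof
        fix w assume w: "w \<in> convex hull (v ` {x..y})"
        let ?z = "v (Suc x)"
        have z: "side x y ?z < 0" using side_inside_neg[of x y "Suc x"] c xy by simp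
        have w0: "side x y w \<le> 0"
          by (rule hull_side_nonpos[OF side_inside_nonpos w]) (use c in auto)
        have sub2: "convex hull (v ` {x..y}) \<subseteq> convex hull (v ` {i..j})"
          using c by (intro hull_mono image_mono) auto
        have zin: "?z \<in> convex hull (v ` {x..y})"
          using xy hull_subset[of "v ` {x..y}" convex] by auto
        \<comment> \<open>Moving \<open>w\<close> slightly toward a vertex strictly beyond the chord
          makes its sign strict; the sequence converges back to \<open>w\<close>.\<close>
        define f where "f k = (1 - inverse (real (Suc k))) *\<^sub>R w + inverse (real (Suc k)) *\<^sub>R ?z" for k
        have fin: "f k \<in> \<Union>(tri ` ?S)" for k
        proof (rule negin)
          have e: "0 < inverse (real (Suc k))" "inverse (real (Suc k)) \<le> 1"
            by (simp_all add: inverse_le_1_iff)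
          have "f k \<in> convex hull (v ` {x..y})"
            unfolding f_def using w zin e by (intro convexD[OF convex_convex_hull]) auto
          then show "f k \<in> convex hull (v ` {i..j})" using sub2 by blast
          have "side x y (f k) = (1 - inverse (real (Suc k))) * side x y w + inverse (real (Suc k)) * side x y ?z"
            unfolding f_def by (subst side_comb2) auto
          moreover have "(1 - inverse (real (Suc k))) * side x y w \<le> 0"
            using e w0 by (intro mult_nonneg_nonpos) auto
          moreover have "inverse (real (Suc k)) * side x y ?z < 0"
            using e z by (intro mult_pos_neg) auto
          ultimately show "side x y (f k) < 0" by linarith
        qed
        have "(\<lambda>k. (1 - inverse (real (Suc k))) *\<^sub>R w + inverse (real (Suc k)) *\<^sub>R ?z)
            \<longlonglongrightarrow> (1 - 0) *\<^sub>R w + 0 *\<^sub>R ?z"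
          by (intro tendsto_intros LIMSEQ_inverse_real_of_nat)
        then have "f \<longlonglongrightarrow> w" unfolding f_def by simp
        then show "w \<in> \<Union>(tri ` ?S)"
          using closed_sequentially[OF cl] fin by blast
      qed
    qed
    then have "\<Union>(tri ` ?S) = region x y" using xy by (simp add: region_def)
    moreover have "(tri s \<inter> tri t) face_of tri s" if "s \<in> ?S" "t \<in> ?S" for s t
    proof -
      have "s \<in> S" "t \<in> S" using that by auto
      then show ?thesis using S by (simp add: dissections_def)
    qed
    ultimately show ?thesis
      unfolding dissections_def using St by (intro CollectI conjI ballI)
  qed
qed

section \<open>Gluing two dissections along a triangle\<close>

text \<open>The ends of the chord serve as the independent set \<open>K\<close>: by strictness no
  other vertex of the two triangles lies on the line of the chord.\<close>

lemma face_across_chord: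
  assumes s: "admissible (p, q, r)" "x \<le> p" "r \<le> y"
    and t: "admissible (p', q', r')" "\<And>m. m \<in> {p', q', r'} \<Longrightarrow> m \<le> x \<or> y \<le> m"
    and c: "E x y" "y \<le> n"
  shows "(tri (p, q, r) \<inter> tri (p', q', r')) face_of tri (p, q, r)"
    and "(tri (p', q', r') \<inter> tri (p, q, r)) face_of tri (p', q', r')"
proof -
  have a: "p < q" "q < r" "r \<le> n" "p' < q'" "q' < r'" "r' \<le> n"
    using s(1) t(1) by (auto simp: admissible_def)
  have xy: "Suc x < y" using a s by simp
  have V: "\<sigma> * orient (v x) (v y) z \<le> 0" if "z \<in> {v p, v q, v r}" for z
    using that side_inside_nonpos[of x _ y] a s c unfolding side_def by auto
  have W: "0 \<le> \<sigma> * orient (v x) (v y) z" if "z \<in> {v p', v q', v r'}" for z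
  proof -
    have "z \<in> v ` {p', q', r'}" using that by simp
    then obtain m where m: "m \<in> {p', q', r'}" "z = v m" by blast
    have "m \<le> n" using m(1) a by auto
    then have "0 \<le> side x y (v m)" using side_outside_nonneg[of x y m] t(2)[OF m(1)] xy c by simp
    then show ?thesis using m(2) by (simp add: side_def)
  qed
  have K: "\<not> affine_dependent {v x, v y}" by (rule affine_independent_2)
  have L: "z \<in> {v x, v y}"
    if z: "z \<in> {v p, v q, v r} \<union> {v p', v q', v r'}" "\<sigma> * orient (v x) (v y) z = 0" for z
  proof -
    have "z \<in> v ` ({p, q, r} \<union> {p', q', r'})" using z(1) by simp
    then obtain m where m: "m \<in> {p, q, r} \<union> {p', q', r'}" "z = v m" by blast
    have mn: "m \<le> n" using m(1) a by auto
    have "side x y (v m) = 0" using z(2) m(2) by (simp add: side_def)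
    then have "\<not> (x < m \<and> m < y)" "\<not> (m < x \<or> y < m)"
      using side_inside_neg[of x y m] side_outside_pos[of x y m] c xy mn by auto
    then have "m = x \<or> m = y" by linarith
    then show ?thesis using m(2) by auto
  qed
  show "(tri (p, q, r) \<inter> tri (p', q', r')) face_of tri (p, q, r)"
    unfolding tri_def prod.case
    by (rule opposite_sides_face(1)[OF tri_indep[OF s(1)] V tri_indep[OF t(1)] W K L])
  show "(tri (p', q', r') \<inter> tri (p, q, r)) face_of tri (p', q', r')"
    unfolding tri_def prod.case
    by (rule opposite_sides_face(2)[OF tri_indep[OF s(1)] V tri_indep[OF t(1)] W K L])
qed

text \<open>The signs of a point against the two inner edges decide where it lies: a negative sign
  puts it into a cut-off part by \<open>hull_split\<close>, and otherwise all three signs fit the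
  triangle.\<close>

lemma join_region:
  assumes t: "admissible (i, k, j)"
  shows "tri (i, k, j) \<union> region i k \<union> region k j = region i j"
proof -
  have a: "i < k" "k < j" "j \<le> n" "E i k" "E k j" using t by (auto simp: admissible_def base_def)
  have ij: "region i j = convex hull (v ` {i..j})" using a by (simp add: region_def)
  show ?thesis
  proof
    have "convex hull (v ` {i..k}) \<subseteq> convex hull (v ` {i..j})"
      "convex hull (v ` {k..j}) \<subseteq> convex hull (v ` {i..j})"
      by (intro hull_mono image_mono; use a in auto)+
    then show "tri (i, k, j) \<union> region i k \<union> region k j \<subseteq> region i j"
      unfolding ij using tri_subset_hull[of i i k j j] a by (auto simp: region_def)
    show "region i j \<subseteq> tri (i, k, j) \<union> region i k \<union> region k j"
    proof
      fix w assume "w \<in> region i j"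
      then have w: "w \<in> convex hull (v ` {i..j})" using ij by simp
      have left: "w \<in> region i k" if "side i k w < 0"
      proof -
        \<comment> \<open>For neighbouring vertices \<open>region\<close> is empty, so it must be
          shown that no point of the polygon lies beyond a boundary edge.\<close>
        have "Suc i \<noteq> k"
        proof
          assume "Suc i = k"
          then have "0 \<le> side i k w"
            by (intro hull_side_nonneg[OF side_outside_nonneg w]) (use a in auto)
          then show False using that by simp
        qed
        then have "Suc i < k" using a by simp
        then show ?thesis using hull_split[of i k i j w] that w a by (simp add: region_def)
      qed
      have right: "w \<in> region k j" if "side k j w < 0"
      proof -
        have "Suc k \<noteq> j"
        proof
          assume "Suc k = j"
          then have "0 \<le> side k j w"
            by (intro hull_side_nonneg[OF side_outside_nonneg w]) (use a in auto)
          then show False using that by simp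
        qed
        then have "Suc k < j" using a by simp
        then show ?thesis using hull_split[of k j i j w] that w a by (simp add: region_def)
      qed
      have "side i j w \<le> 0"
        by (rule hull_side_nonpos[OF side_inside_nonpos w]) (use a in auto)
      then have "0 \<le> \<sigma> * orient (v j) (v i) w"
        unfolding side_def by (simp add: orient_def algebra_simps)
      then have "w \<in> tri (i, k, j)" if "0 \<le> side i k w" "0 \<le> side k j w"
        unfolding tri_def prod.case
        using in_triangle_orient[of \<sigma> "v i" "v k" "v j" w] that admissible_pos[OF t]
        unfolding side_def by blast
      then show "w \<in> tri (i, k, j) \<union> region i k \<union> region k j"
        using left right by (meson UnCI not_less)
    qed
  qed
qed

lemma dissections_tripleD:
  assumes "S \<in> dissections F i j" "(p, q, r) \<in> S"
  shows "admissible (p, q, r)" "F (p, q, r)" "i \<le> p" "p < q" "q < r" "r \<le> j"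
  using assms by (auto simp: dissections_def triples_def admissible_def)

lemma dissections_face:
  assumes "S \<in> dissections F i j" "s \<in> S" "t \<in> S"
  shows "(tri s \<inter> tri t) face_of tri s"
  using assms by (auto simp: dissections_def)

lemma dissections_join:
  assumes S1: "S1 \<in> dissections F i k" and S2: "S2 \<in> dissections F k j"
    and t: "admissible (i, k, j)" "F (i, k, j)"
  shows "insert (i, k, j) (S1 \<union> S2) \<in> dissections F i j"
proof -
  have a: "i < k" "k < j" "j \<le> n" "E i k" "E k j" using t by (auto simp: admissible_def base_def)
  have sub: "insert (i, k, j) (S1 \<union> S2) \<subseteq> triples F i j"
  proof
    fix u assume "u \<in> insert (i, k, j) (S1 \<union> S2)"
    moreover obtain p q r where "u = (p, q, r)" by (cases u)
    ultimately show "u \<in> triples F i j"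
      using dissections_tripleD[OF S1, of p q r] dissections_tripleD[OF S2, of p q r] t a
      by (auto simp: triples_def)
  qed
  have S1t: "(tri s \<inter> tri u) face_of tri s \<and> (tri u \<inter> tri s) face_of tri u"
    if su: "s \<in> S1" "u \<in> insert (i, k, j) S2" for s u
  proof -
    obtain p q r p' q' r' where e: "s = (p, q, r)" "u = (p', q', r')" by (metis prod_cases3)
    have s: "admissible (p, q, r)" "i \<le> p" "r \<le> k" using dissections_tripleD[OF S1, of p q r] su e by auto
    have "u = (i, k, j) \<or> u \<in> S2" using su by auto
    then have "admissible (p', q', r') \<and> (\<forall>m\<in>{p', q', r'}. m \<le> i \<or> k \<le> m)"
      using e t a dissections_tripleD[OF S2, of p' q' r'] by auto
    then show ?thesis
      unfolding e using face_across_chord[OF s, of p' q' r'] a by auto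
  qed
  have S2t: "(tri s \<inter> tri (i, k, j)) face_of tri s \<and> (tri (i, k, j) \<inter> tri s) face_of tri (i, k, j)"
    if "s \<in> S2" for s
  proof -
    obtain p q r where e: "s = (p, q, r)" by (metis prod_cases3)
    have s: "admissible (p, q, r)" "k \<le> p" "r \<le> j" using dissections_tripleD[OF S2, of p q r] that e by auto
    have "m \<le> k \<or> j \<le> m" if "m \<in> {i, k, j}" for m using that a by auto
    then show ?thesis
      unfolding e using face_across_chord[OF s t(1)] a by blast
  qed
  have refl: "(tri (i, k, j) \<inter> tri (i, k, j)) face_of tri (i, k, j)"
    by (simp add: tri_def face_of_refl)
  have "(tri s \<inter> tri u) face_of tri s"
    if "s \<in> insert (i, k, j) (S1 \<union> S2)" "u \<in> insert (i, k, j) (S1 \<union> S2)" for s u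
    using that S1t S2t refl dissections_face[OF S1] dissections_face[OF S2] by blast
  moreover have "\<Union>(tri ` insert (i, k, j) (S1 \<union> S2)) = region i j"
    using join_region[OF t(1)] S1 S2 by (auto simp: dissections_def)
  ultimately show ?thesis unfolding dissections_def using sub by (intro CollectI conjI ballI)
qed

text \<open>Since no triangle straddles \<open>k\<close>, every triangle outside one part has its
  vertices on the far side of the cutting edge, as \<open>cut_region\<close> requires.\<close>

lemma dissections_split:
  assumes S: "S \<in> dissections F i j" and t: "(i, k, j) \<in> S"
  shows "{(p, q, r) \<in> S. i \<le> p \<and> r \<le> k} \<in> dissections F i k"
    and "{(p, q, r) \<in> S. k \<le> p \<and> r \<le> j} \<in> dissections F k j"
    and "S = insert (i, k, j) ({(p, q, r) \<in> S. i \<le> p \<and> r \<le> k} \<union> {(p, q, r) \<in> S. k \<le> p \<and> r \<le> j})"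
proof -
  have adm: "admissible (i, k, j)" using dissections_tripleD[OF S t] by simp
  have a: "i < k" "k < j" "j \<le> n" "E i k" "E k j" using adm by (auto simp: admissible_def base_def)
  have sep: "(p, q, r) = (i, k, j) \<or> r \<le> k \<or> k \<le> p" if "(p, q, r) \<in> S" for p q r
    using triangle_separates[OF S t that] by blast
  show "{(p, q, r) \<in> S. i \<le> p \<and> r \<le> k} \<in> dissections F i k"
  proof (rule cut_region[OF S])
    fix p q r m
    assume u: "(p, q, r) \<in> S" "\<not> (i \<le> p \<and> r \<le> k)" "m \<in> {p, q, r}"
    have d: "i \<le> p" "p < q" "q < r" "r \<le> j" using dissections_tripleD[OF S u(1)] by auto
    have "m \<le> n" "m \<le> i \<or> k \<le> m" using sep[OF u(1)] u(2,3) d a by auto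
    then show "0 \<le> side i k (v m)" using side_outside_nonneg[of i k m] a by simp
  qed (use a in auto)
  show "{(p, q, r) \<in> S. k \<le> p \<and> r \<le> j} \<in> dissections F k j"
  proof (rule cut_region[OF S])
    fix p q r m
    assume u: "(p, q, r) \<in> S" "\<not> (k \<le> p \<and> r \<le> j)" "m \<in> {p, q, r}"
    have d: "i \<le> p" "p < q" "q < r" "r \<le> j" using dissections_tripleD[OF S u(1)] by auto
    have "m \<le> n" "m \<le> k \<or> j \<le> m" using sep[OF u(1)] u(2,3) d a by auto
    then show "0 \<le> side k j (v m)" using side_outside_nonneg[of k j m] a by simp
  qed (use a in auto)
  show "S = insert (i, k, j) ({(p, q, r) \<in> S. i \<le> p \<and> r \<le> k} \<union> {(p, q, r) \<in> S. k \<le> p \<and> r \<le> j})"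
    (is "S = ?R")
  proof
    show "?R \<subseteq> S" using t by auto
    show "S \<subseteq> ?R"
    proof
      fix u assume u: "u \<in> S"
      obtain p q r where e: "u = (p, q, r)" by (metis prod_cases3)
      then show "u \<in> ?R"
        using u sep[of p q r] dissections_tripleD(3,6)[OF S, of p q r] by auto
    qed
  qed
qed

text \<open>Cutting and gluing are inverse to each other: a dissection corresponds to the apex
  \<open>k\<close> on its base together with a pair of smaller dissections.\<close>

lemma card_dissections:
  assumes b: "base i j" "Suc i < j"
  shows "card (dissections F i j) =
    (\<Sum>k | i < k \<and> k < j \<and> E i k \<and> E k j \<and> F (i, k, j).
       card (dissections F i k) * card (dissections F k j))"
proof -
  let ?K = "{k. i < k \<and> k < j \<and> E i k \<and> E k j \<and> F (i, k, j)}"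
  define f where "f k = (\<lambda>(S1, S2). insert (i, k, j) (S1 \<union> S2))" for k :: nat
  define D where "D k = dissections F i k \<times> dissections F k j" for k
  have K: "k \<in> ?K \<longleftrightarrow> admissible (i, k, j) \<and> F (i, k, j)" for k
    using b by (auto simp: admissible_def base_def)
  have "dissections F i j = (\<Union>k\<in>?K. f k ` D k)"
  proof
    show "dissections F i j \<subseteq> (\<Union>k\<in>?K. f k ` D k)"
    proof
      fix S assume S: "S \<in> dissections F i j"
      obtain k where k: "(i, k, j) \<in> S" using base_triangle[OF S b] by blast
      have "k \<in> ?K" using dissections_tripleD(1,2)[OF S k] K by blast
      moreover have "S \<in> f k ` D k"
        unfolding f_def D_def
        by (intro image_eqI[where x="({(p, q, r) \<in> S. i \<le> p \<and> r \<le> k}, {(p, q, r) \<in> S. k \<le> p \<and> r \<le> j})"])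
          (use dissections_split[OF S k] in auto)
      ultimately show "S \<in> (\<Union>k\<in>?K. f k ` D k)" by blast
    qed
    show "(\<Union>k\<in>?K. f k ` D k) \<subseteq> dissections F i j"
    proof (intro UN_least image_subsetI)
      fix k d assume k: "k \<in> ?K" and d: "d \<in> D k"
      then show "f k d \<in> dissections F i j"
        using dissections_join[of "fst d" F i k "snd d" j] K[of k]
        by (auto simp: f_def D_def split: prod.split)
    qed
  qed
  moreover have "card (\<Union>k\<in>?K. f k ` D k) = (\<Sum>k\<in>?K. card (f k ` D k))"
  proof (rule card_UN_disjoint)
    show "\<forall>k\<in>?K. \<forall>l\<in>?K. k \<noteq> l \<longrightarrow> f k ` D k \<inter> f l ` D l = {}"
    proof (intro ballI impI equals0I)
      fix k l S assume kl: "k \<in> ?K" "l \<in> ?K" "k \<noteq> l" and S: "S \<in> f k ` D k \<inter> f l ` D l"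
      obtain S1 S2 where d: "S1 \<in> dissections F i k" "S2 \<in> dissections F k j" "S = insert (i, k, j) (S1 \<union> S2)"
        using IntD1[OF S] by (auto simp: f_def D_def)
      obtain e where "S = f l e" using IntD2[OF S] by blast
      then have "(i, l, j) \<in> S" by (simp add: f_def split: prod.split)
      then show False
        using d(3) kl dissections_tripleD[OF d(1), of i l j] dissections_tripleD[OF d(2), of i l j] by auto
    qed
  qed (auto simp: D_def dissections_finite)
  moreover have "card (f k ` D k) = card (dissections F i k) * card (dissections F k j)" if k: "k \<in> ?K" for k
  proof -
    \<comment> \<open>Position relative to \<open>k\<close> recovers both parts from their union;
      the base triangle itself passes neither test, since \<open>i < k < j\<close>.\<close>
    have part: "S1 = {(p, q, r) \<in> f k (S1, S2). r \<le> k} \<and> S2 = {(p, q, r) \<in> f k (S1, S2). k \<le> p}"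
      if S: "S1 \<in> dissections F i k" "S2 \<in> dissections F k j" for S1 S2
      using k dissections_tripleD[OF S(1)] dissections_tripleD[OF S(2)]
      by (fastforce simp: f_def)
    have "inj_on (f k) (D k)"
    proof (rule inj_onI)
      fix d e assume de: "d \<in> D k" "e \<in> D k" "f k d = f k e"
      obtain S1 S2 T1 T2 where "d = (S1, S2)" "e = (T1, T2)" by (metis surj_pair)
      then show "d = e" using de part[of S1 S2] part[of T1 T2] by (auto simp: D_def)
    qed
    then show ?thesis by (simp add: card_image D_def card_cartesian_product)
  qed
  ultimately show ?thesis by simp
qed

section \<open>From index triples to triangulations as sets of triangles\<close>

lemma extreme_points_tri:
  assumes "admissible (p, q, r)"
  shows "{x. x extreme_point_of tri (p, q, r)} = {v p, v q, v r}"
  unfolding tri_def prod.case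
  using extreme_point_of_convex_hull_affine_independent[OF tri_indep[OF assms]] by blast

lemma simplex_tri:
  assumes "admissible (p, q, r)"
  shows "2 simplex tri (p, q, r)"
proof -
  have "orient (v p) (v q) (v r) \<noteq> 0" using admissible_pos[OF assms] by (auto simp: side_def)
  then have "card {v p, v q, v r} = 3" using orient_nonzero_distinct by (simp add: card_insert_if)
  then show ?thesis
    unfolding tri_def prod.case using simplex_convex_hull[of "{v p, v q, v r}" 2] tri_indep[OF assms] by simp
qed

text \<open>A triangle determines its extreme points, injectivity of \<open>v\<close> gives back the
  index set, and sorting gives back the increasing triple.\<close>

lemma tri_inj:
  assumes inj: "inj_on v {..n}" and s: "admissible s" and t: "admissible t" and eq: "tri s = tri t"
  shows "s = t"
proof -
  obtain p q r p' q' r' where e: "s = (p, q, r)" "t = (p', q', r')" by (metis prod_cases3)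
  have a: "p < q" "q < r" "r \<le> n" "p' < q'" "q' < r'" "r' \<le> n"
    using s t by (auto simp: admissible_def e)
  have "v ` {p, q, r} = v ` {p', q', r'}"
    using extreme_points_tri[of p q r] extreme_points_tri[of p' q' r'] s t eq unfolding e by simp
  moreover have "{p, q, r} \<subseteq> {..n}" "{p', q', r'} \<subseteq> {..n}" using a by auto
  ultimately have "{p, q, r} = {p', q', r'}"
    using inj_on_image_eq_iff[OF inj] by blast
  then have J: "sorted_list_of_set {p, q, r} = sorted_list_of_set {p', q', r'}" by (rule arg_cong)
  have srt: "sorted_list_of_set {x, y, z} = [x, y, z]" if "x < y" "y < z" for x y z :: nat
  proof -
    have "sorted_list_of_set (set [x, y, z]) = [x, y, z]"
      using that by (intro sorted_list_of_set.idem_if_sorted_distinct) auto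
    then show ?thesis by (simp only: list.set)
  qed
  show ?thesis
    using J unfolding e srt[OF a(1,2)] srt[OF a(4,5)] by simp
qed

text \<open>Sorting the three indices turns the clause on triangles in \<open>triangulations\<close>
  into \<open>admissible\<close>: an edge is free of points exactly if it is a \<open>base\<close>
  pair.\<close>

lemma empty_triangle_iff:
  assumes inj: "inj_on v {..n}"
    and empty: "\<And>p q. \<lbrakk>p < q; q \<le> n\<rbrakk> \<Longrightarrow> v ` {..n} \<inter> open_segment (v p) (v q) = {} \<longleftrightarrow> base p q"
  shows "(2 simplex T \<and> (\<forall>x. x extreme_point_of T \<longrightarrow> x \<in> v ` {..n}) \<and>
      (\<forall>x y. x extreme_point_of T \<and> y extreme_point_of T \<longrightarrow> v ` {..n} \<inter> open_segment x y = {}))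
    \<longleftrightarrow> (\<exists>t. admissible t \<and> T = tri t)" (is "?L \<longleftrightarrow> ?R")
proof
  assume L: ?L
  then obtain V where V: "\<not> affine_dependent V" "card V = 3" "T = convex hull V"
    unfolding simplex_def by auto
  have ext: "x extreme_point_of T \<longleftrightarrow> x \<in> V" for x
    using extreme_point_of_convex_hull_affine_independent[OF V(1)] V(3) by simp
  then have "V \<subseteq> v ` {..n}" using L by blast
  then obtain J where J: "J \<subseteq> {..n}" "V = v ` J" using subset_imageE by metis
  then have "card J = 3" using V(2) inj by (metis card_image inj_on_subset)
  moreover have "finite J" using J(1) finite_subset by blast
  ultimately obtain xs where xs: "sorted_wrt (<) xs" "set xs = J" "length xs = 3"
    using finite_set_strict_sorted by metis
  obtain p q r where "xs = [p, q, r]" using xs(3) by (auto simp: numeral_3_eq_3 length_Suc_conv)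
  then have pqr: "p < q" "q < r" "J = {p, q, r}" using xs by auto
  have rn: "r \<le> n" using J(1) pqr by auto
  have b: "base x y" if "x \<in> J" "y \<in> J" "x < y" for x y
    using empty[of x y] that L ext J by auto
  have "base p q" "base q r" "base p r" using b pqr by auto
  then have "admissible (p, q, r)"
    using pqr rn by (auto simp: admissible_def base_def)
  moreover have "T = tri (p, q, r)" unfolding V(3) J(2) pqr(3) tri_def by simp
  ultimately show ?R by blast
next
  assume ?R
  then obtain p q r where t: "admissible (p, q, r)" "T = tri (p, q, r)" by (metis prod_cases3)
  have a: "p < q" "q < r" "r \<le> n" "base p q" "base q r" "base p r"
    using t(1) by (auto simp: admissible_def base_def)
  have ext: "x extreme_point_of T \<longleftrightarrow> x \<in> {v p, v q, v r}" for x
    using extreme_points_tri[OF t(1)] t(2) by blast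
  have e: "v ` {..n} \<inter> open_segment (v x) (v y) = {}" if "x \<in> {p, q, r}" "y \<in> {p, q, r}" for x y
  proof -
    have "base x y \<or> base y x \<or> x = y" using that a by auto
    then show ?thesis
      using empty[of x y] empty[of y x] that a by (auto simp: base_def open_segment_commute)
  qed
  have "v ` {..n} \<inter> open_segment x y = {}" if xy: "x extreme_point_of T" "y extreme_point_of T" for x y
  proof -
    have "x \<in> v ` {p, q, r}" "y \<in> v ` {p, q, r}" using xy ext by auto
    then show ?thesis using e by blast
  qed
  moreover have "2 simplex T" using simplex_tri t by simp
  moreover have "\<forall>x. x extreme_point_of T \<longrightarrow> x \<in> v ` {..n}" using ext a by auto
  ultimately show ?L by blast
qed

text \<open>Taking images under \<open>tri\<close> is a bijection from dissections to
  triangulations. \<open>F\<close> is the counterpart on indices of the geometric condition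
  \<open>Q\<close>; the finiteness is wanted later for subtracting cardinalities.\<close>

lemma card_triangulations_eq:
  assumes inj: "inj_on v {..n}" and n: "2 \<le> n"
    and empty: "\<And>p q. \<lbrakk>p < q; q \<le> n\<rbrakk> \<Longrightarrow> v ` {..n} \<inter> open_segment (v p) (v q) = {} \<longleftrightarrow> base p q"
    and hull: "convex hull (v ` {..n}) = convex hull {A, B, C}"
    and F: "\<And>t. admissible t \<Longrightarrow> F t \<longleftrightarrow> Q (tri t)"
  shows "card {\<T> \<in> triangulations A B C (v ` {..n}). \<forall>T\<in>\<T>. Q T} = card (dissections F 0 n)"
    and "finite {\<T> \<in> triangulations A B C (v ` {..n}). \<forall>T\<in>\<T>. Q T}"
proof -
  let ?X = "{\<T> \<in> triangulations A B C (v ` {..n}). \<forall>T\<in>\<T>. Q T}"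
  have reg: "region 0 n = convex hull {A, B, C}"
    using n hull by (simp add: region_def atMost_atLeast0)
  have tr: "triangulations A B C (v ` {..n}) = {\<T>. triangulation \<T> \<and> \<Union>\<T> = convex hull {A, B, C} \<and>
      (\<forall>T\<in>\<T>. \<exists>t. admissible t \<and> T = tri t)}"
    unfolding triangulations_def using empty_triangle_iff[OF inj empty] by presburger
  have "?X = (`) tri ` dissections F 0 n"
  proof
    show "?X \<subseteq> (`) tri ` dissections F 0 n"
    proof
      fix \<T> assume X: "\<T> \<in> ?X"
      define S where "S = {t. admissible t \<and> tri t \<in> \<T>}"
      have adm: "\<exists>t. admissible t \<and> T = tri t" if "T \<in> \<T>" for T
        using X that unfolding tr by blast
      then have \<T>: "\<T> = tri ` S" unfolding S_def by blast
      have "S \<subseteq> triples F 0 n"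
      proof
        fix t assume t: "t \<in> S"
        then have "F t" using F X by (auto simp: S_def)
        then show "t \<in> triples F 0 n"
          using t by (cases t) (auto simp: S_def triples_def admissible_def)
      qed
      moreover have "(tri s \<inter> tri t) face_of tri s" if "s \<in> S" "t \<in> S" for s t
        using X that unfolding S_def tr by (simp add: triangulation_def)
      moreover have "\<Union>(tri ` S) = region 0 n"
        using X unfolding reg tr by (simp add: \<T>)
      ultimately have "S \<in> dissections F 0 n" unfolding dissections_def by (intro CollectI conjI ballI)
      then show "\<T> \<in> (`) tri ` dissections F 0 n" using \<T> by blast
    qed
    show "(`) tri ` dissections F 0 n \<subseteq> ?X"
    proof
      fix \<T> assume "\<T> \<in> (`) tri ` dissections F 0 n"
      then obtain S where S: "S \<in> dissections F 0 n" "\<T> = tri ` S" by blast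
      have SF: "admissible t" "F t" if "t \<in> S" for t
        using S(1) that by (cases t; auto simp: dissections_def triples_def)+
      have good: "\<exists>t. admissible t \<and> T = tri t" if "T \<in> \<T>" for T
        using that S(2) SF by blast
      have simplex: "\<exists>m. m simplex T" if "T \<in> \<T>" for T
      proof -
        from good[OF that] obtain p q r where "admissible (p, q, r)" "T = tri (p, q, r)"
          by (metis prod_cases3)
        then show ?thesis using simplex_tri by blast
      qed
      have face: "(T \<inter> T') face_of T" if "T \<in> \<T>" "T' \<in> \<T>" for T T'
        using S that by (auto simp: dissections_def)
      have "finite S" using S(1) finite_subset[OF _ triples_finite] unfolding dissections_def by blast
      then have "triangulation \<T>"
        unfolding triangulation_def using S(2) simplex face by blast
      moreover have "\<Union>\<T> = convex hull {A, B, C}" using S reg by (simp add: dissections_def)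
      moreover have "\<forall>T\<in>\<T>. Q T" using S(2) SF F by blast
      ultimately show "\<T> \<in> ?X" using good unfolding tr by blast
    qed
  qed
  moreover have "inj_on ((`) tri) (dissections F 0 n)"
  proof (rule inj_on_subset)
    have "inj_on tri {t. admissible t}" using tri_inj[OF inj] by (intro inj_onI) auto
    then show "inj_on ((`) tri) (Pow {t. admissible t})" by (rule inj_on_image_Pow)
    show "dissections F 0 n \<subseteq> Pow {t. admissible t}"
      by (auto simp: dissections_def triples_def)
  qed
  ultimately show "card ?X = card (dissections F 0 n)" "finite ?X"
    by (simp_all add: card_image dissections_finite)
qed

end

section \<open>The recursion for a subdivided triangle\<close>

text \<open>The limit is an integer, so that \<open>k - 1\<close> is not truncated and a negative
  limit gives the empty sum of the theorem.\<close>

definition binom_sum :: "nat \<Rightarrow> int \<Rightarrow> int" where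
  "binom_sum m k = (\<Sum>l = 0..k. binom m l)"

lemma binom_neg [simp]: "k < 0 \<Longrightarrow> binom m k = 0"
  by (simp add: binom_def)

lemma binom_of_nat [simp]: "binom m (int k) = int (m choose k)"
  by (simp add: binom_def)

lemma binom_Suc: "binom (Suc m) k = binom m k + binom m (k - 1)"
proof (cases "k < 0")
  case False
  then obtain j where j: "k = int j" using nonneg_int_cases[of k] by auto
  show ?thesis
  proof (cases j)
    case (Suc i)
    then have "k - 1 = int i" using j by simp
    then show ?thesis using Suc j by (simp only: binom_of_nat) simp
  qed (simp add: j binom_def)
qed simp

lemma binom_symmetric: "binom m k = binom m (int m - k)"
proof (cases "0 \<le> k \<and> k \<le> int m")
  case True
  then obtain j where j: "k = int j" "j \<le> m" using nonneg_int_cases[of k] by auto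
  then have "int m - k = int (m - j)" by simp
  then show ?thesis using j binomial_symmetric[of j m] by (simp only: binom_of_nat)
next
  case False
  then have "k < 0 \<or> k > int m" by auto
  then show ?thesis by (auto simp: binom_def)
qed

lemma binom_sum_neg [simp]: "k < 0 \<Longrightarrow> binom_sum m k = 0"
  by (simp add: binom_sum_def)

lemma binom_sum_step: "binom_sum m k = binom_sum m (k - 1) + binom m k"
proof (cases "k < 0")
  case False
  then have "{0..k} = insert k {0..k - 1}" by auto
  then show ?thesis by (simp add: binom_sum_def)
qed simp

lemma binom_sum_Suc: "binom_sum (Suc m) k = binom_sum m k + binom_sum m (k - 1)"
proof (cases "k < 0")
  case False
  then have "0 \<le> k" by simp
  then show ?thesis
  proof (induction k rule: int_ge_induct)
    case base
    then show ?case using binom_sum_step[of "Suc m" 0] binom_sum_step[of m 0] by (simp add: binom_Suc)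
  next
    case (step k)
    then show ?case
      using binom_sum_step[of "Suc m" "k + 1"] binom_sum_step[of m "k + 1"] binom_sum_step[of m k]
      by (simp add: binom_Suc)
  qed
qed simp

text \<open>By symmetry of the row, the second sum equals the part of the row above
  \<open>k\<close>, so together they exhaust it. The induction splits both sums by Pascal's
  rule.\<close>

lemma binom_sum_complement: "binom_sum m k + binom_sum m (int m - 1 - k) = 2 ^ m"
proof (induction m arbitrary: k)
  case 0
  have "binom_sum 0 j = 1" if "0 \<le> j" for j
    using that
  proof (induction j rule: int_ge_induct)
    case base
    then show ?case using binom_sum_step[of 0 0] by (simp add: binom_def)
  next
    case (step j)
    then show ?case using binom_sum_step[of 0 "j + 1"] by (simp add: binom_def)
  qed
  then show ?case by (cases "0 \<le> k") auto
next
  case (Suc m)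
  have e: "int (Suc m) - 1 - k - 1 = int m - 1 - k" "int m - 1 - (k - 1) = int (Suc m) - 1 - k" by auto
  show ?case
    using Suc.IH[of k] Suc.IH[of "k - 1"]
    unfolding binom_sum_Suc e by simp
qed

text \<open>Both sides count subsets of size \<open>p + q + 1\<close> in a set of size
  \<open>p + q + a\<close>, the left one by the position \<open>p + x + 1\<close> of the element of
  rank \<open>p + 1\<close>. The proof is a double induction instead.\<close>

lemma sum_choose_convolution:
  "(\<Sum>x<a. (p + x choose p) * ((a - 1 - x) + q choose q)) = (p + q + a choose (p + q + 1))"
proof (induction q arbitrary: a)
  case 0
  show ?case
  proof (induction a)
    case (Suc a)
    have "(\<Sum>x<Suc a. (p + x choose p) * ((Suc a - 1 - x) + 0 choose 0)) = (p + a choose (p + 1)) + (p + a choose p)"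
      using Suc by simp
    then show ?case by simp
  qed simp
next
  case (Suc q)
  note IHq = Suc
  show ?case
  proof (induction a)
    case (Suc a)
    \<comment> \<open>Pascal's rule on the second factor: the first sum is the case of smaller
      \<open>q\<close>; the second loses its last term, which is 0, and is the case of smaller
      \<open>a\<close>.\<close>
    have "(\<Sum>x<Suc a. (p + x choose p) * ((Suc a - 1 - x) + Suc q choose Suc q))
      = (\<Sum>x<Suc a. (p + x choose p) * ((a - x) + q choose q))
      + (\<Sum>x<Suc a. (p + x choose p) * ((a - x) + q choose Suc q))"
      by (simp add: distrib_left sum.distrib)
    also have "(\<Sum>x<Suc a. (p + x choose p) * ((a - x) + q choose q)) = (p + q + Suc a choose (p + q + 1))"
      using IHq[of "Suc a"] by simp
    also have "(\<Sum>x<Suc a. (p + x choose p) * ((a - x) + q choose Suc q))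
      = (\<Sum>x<a. (p + x choose p) * ((a - x) + q choose Suc q))"
      by simp
    also have "\<dots> = (\<Sum>x<a. (p + x choose p) * ((a - 1 - x) + Suc q choose Suc q))"
    proof (intro sum.cong refl)
      fix x assume "x \<in> {..<a}"
      then have "a - x + q = a - 1 - x + Suc q" by auto
      then show "(p + x choose p) * (a - x + q choose Suc q) = (p + x choose p) * (a - 1 - x + Suc q choose Suc q)"
        by simp
    qed
    also have "\<dots> = (p + Suc q + a choose (p + Suc q + 1))" by (rule Suc.IH)
    finally show ?case by simp
  qed simp
qed

text \<open>Around a corner \<open>m\<close>, the triangle on a chord can only advance one of its two ends to the
  neighbouring point, so the dissections are lattice paths.\<close>

lemma lattice_path_recursion:
  fixes N :: "nat \<Rightarrow> nat \<Rightarrow> nat"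
  assumes rec: "\<And>x y. \<lbrakk>i \<le> x; x < m; m < y; y \<le> j\<rbrakk> \<Longrightarrow>
      N x y = (\<Sum>k | x < k \<and> k < y \<and> E x k \<and> E k y \<and> F (x, k, y). N x k * N k y)"
    and unit: "\<And>x. N x (Suc x) = 1"
    and lower: "\<And>x y. \<lbrakk>i \<le> x; x < y; y \<le> m\<rbrakk> \<Longrightarrow> E x y \<longleftrightarrow> y = Suc x"
    and upper: "\<And>x y. \<lbrakk>m \<le> x; x < y; y \<le> j\<rbrakk> \<Longrightarrow> E x y \<longleftrightarrow> y = Suc x"
    and cross: "\<And>x y. \<lbrakk>i \<le> x; x < m; m < y; y \<le> j; x \<noteq> i \<or> y \<noteq> j\<rbrakk> \<Longrightarrow> E x y"
    and allowed: "\<And>x k y. \<lbrakk>i \<le> x; x < k; k < y; y \<le> j\<rbrakk> \<Longrightarrow> F (x, k, y)"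
    and xy: "i \<le> x" "x < m" "m < y" "y \<le> j"
  shows "N x y = ((m - 1 - x) + (y - 1 - m) choose (m - 1 - x))"
  using xy
proof (induction "y - x" arbitrary: x y rule: less_induct)
  case less
  let ?K = "{k. x < k \<and> k < y \<and> E x k \<and> E k y \<and> F (x, k, y)}"
  \<comment> \<open>An apex before \<open>m\<close> must be next to \<open>x\<close>, one after
    \<open>m\<close> next to \<open>y\<close>; the corner \<open>m\<close> itself serves only if
    both ends are its neighbours.\<close>
  have in_K: "k \<in> ?K \<longleftrightarrow> x < k \<and> k < y \<and> (k = m \<and> x = m - 1 \<and> y = Suc m \<or>
      k < m \<and> k = Suc x \<or> m < k \<and> y = Suc k)" for k
  proof (cases "x < k \<and> k < y")
    case True
    then have "F (x, k, y)" using allowed less.prems by simp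
    moreover consider "k < m" | "k = m" | "m < k" by linarith
    then have "E x k \<and> E k y \<longleftrightarrow> (k = m \<and> x = m - 1 \<and> y = Suc m \<or>
      k < m \<and> k = Suc x \<or> m < k \<and> y = Suc k)"
    proof cases
      case 1
      \<comment> \<open>The pair excepted in \<open>cross\<close> cannot be \<open>k, y\<close>,
        because \<open>i \<le> x < k\<close>; hence the outermost pair may be a closing edge lying
        on one side.\<close>
      then have "E x k \<longleftrightarrow> k = Suc x" "E k y" using True less.prems lower[of x k] cross[of k y] by auto
      then show ?thesis using 1 by auto
    next
      case 2
      then have "E x k \<longleftrightarrow> k = Suc x" "E k y \<longleftrightarrow> y = Suc k" using True less.prems lower[of x k] upper[of k y] by auto
      then show ?thesis using 2 less.prems by auto
    next
      case 3
      then have "E x k" "E k y \<longleftrightarrow> y = Suc k" using True less.prems cross[of x k] upper[of k y] by auto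
      then show ?thesis using 3 by auto
    qed
    ultimately show ?thesis using True by blast
  qed auto
  have N: "N x y = (\<Sum>k\<in>?K. N x k * N k y)" using rec less.prems by simp
  consider (both) "Suc x < m" "Suc m < y" | (left) "Suc x < m" "y = Suc m"
    | (right) "m = Suc x" "Suc m < y" | (none) "m = Suc x" "y = Suc m"
    using less.prems by linarith
  then show ?case
  proof cases
    case both
    \<comment> \<open>One less than the two step counts, so that the claim takes the form of
      Pascal's rule in successors.\<close>
    define p q where "p = m - 2 - x" and "q = y - 2 - m"
    have pq: "m - 1 - x = Suc p" "y - 1 - m = Suc q" "m - 1 - Suc x = p" "y - 1 - 1 - m = q"
      using both unfolding p_def q_def by auto
    have "?K = {Suc x, y - 1}" using both by (intro set_eqI, unfold in_K) auto
    then have "N x y = N x (Suc x) * N (Suc x) y + N x (y - 1) * N (y - 1) y"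
      using both N by simp
    moreover have "N (y - 1) y = 1" using unit[of "y - 1"] both by simp
    moreover have "N (Suc x) y = ((m - 1 - Suc x) + (y - 1 - m) choose (m - 1 - Suc x))"
      by (rule less.hyps) (use less.prems both in auto)
    moreover have "N x (y - 1) = ((m - 1 - x) + (y - 1 - 1 - m) choose (m - 1 - x))"
      by (rule less.hyps) (use less.prems both in auto)
    ultimately show ?thesis unfolding pq unit by simp
  next
    case left
    have "?K = {Suc x}" using left by (intro set_eqI, unfold in_K) auto
    then have "N x y = N (Suc x) y" using N unit by simp
    also have "\<dots> = 1" using less.hyps[of y "Suc x"] less.prems left by simp
    finally show ?thesis using left by simp
  next
    case right
    have "?K = {y - 1}" using right by (intro set_eqI, unfold in_K) auto
    then have "N x y = N x (y - 1) * N (y - 1) y" using N by simp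
    moreover have "N (y - 1) y = 1" using unit[of "y - 1"] right by simp
    moreover have "N x (y - 1) = 1" using less.hyps[of "y - 1" x] less.prems right by simp
    ultimately show ?thesis using right by simp
  next
    case none
    have "?K = {m}" using none by (intro set_eqI, unfold in_K) auto
    then show ?thesis using N unit none by simp
  qed
qed

text \<open>Vertices are numbered from A = 0 through B = \<open>Suc c\<close> and C = \<open>a + c + 2\<close>; the corner A also
  belongs to the last side.\<close>

definition same_side :: "nat \<Rightarrow> nat \<Rightarrow> nat \<Rightarrow> nat \<Rightarrow> bool" where
  "same_side a c p q \<longleftrightarrow> q \<le> Suc c \<or> Suc c \<le> p \<and> q \<le> a + c + 2 \<or> a + c + 2 \<le> p
     \<or> p = 0 \<and> a + c + 2 \<le> q"

text \<open>The pair of 0 and the last vertex lies on CA and is no chord; it enters only as the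
  closing edge in \<open>base\<close>.\<close>

definition chord :: "nat \<Rightarrow> nat \<Rightarrow> nat \<Rightarrow> nat \<Rightarrow> bool" where
  "chord a c p q \<longleftrightarrow> q = Suc p \<or> p < q \<and> \<not> same_side a c p q"

definition central :: "nat \<Rightarrow> nat \<Rightarrow> nat \<times> nat \<times> nat \<Rightarrow> bool" where
  "central a c t = (case t of (p, q, r) \<Rightarrow>
     0 < p \<and> p < Suc c \<and> Suc c < q \<and> q < a + c + 2 \<and> a + c + 2 < r)"

text \<open>The region between a chord from AB to CA and the side BC, with p and q points strictly
  between the chord and B, C; the value -1 means that the chord ends in that corner.\<close>

definition strip_count :: "bool \<Rightarrow> nat \<Rightarrow> int \<Rightarrow> int \<Rightarrow> int" where
  "strip_count full a p q = (let m = nat (p + q + int a + 1) in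
     if full then 2 ^ m - binom_sum m (int a - 1) - binom_sum m (p - 1) - binom_sum m (q - 1)
     else binom m p + binom m q)"

lemma strip_count_commute: "strip_count full a p q = strip_count full a q p"
  by (simp add: strip_count_def Let_def add.commute)

text \<open>A chord ending in a corner leaves only a corner region. In the full count, complementary
  row sums cancel against the power of 2, so both variants give the same coefficient.\<close>

lemma strip_count_boundary:
  assumes "0 \<le> q"
  shows "strip_count full a (-1) q = binom (nat (int a + q)) q"
proof -
  let ?m = "nat (int a + q)"
  have "binom_sum ?m (int a - 1) + binom_sum ?m q = 2 ^ ?m"
    using binom_sum_complement[of ?m "int a - 1"] assms by simp
  then show ?thesis
    using binom_sum_step[of ?m q] by (simp add: strip_count_def Let_def add.commute)
qed

text \<open>The sums with limits \<open>p - 1\<close> and \<open>q - 1\<close> split by Pascal's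
  rule into those of the two shorter strips. The sum with limit \<open>a - 1\<close> is subtracted
  twice there; the extra coefficient corrects this.\<close>

lemma strip_count_rec:
  assumes "0 \<le> p" "0 \<le> q"
  shows "strip_count full a p q = strip_count full a (p - 1) q + strip_count full a p (q - 1)
     + (if full then binom (nat (p + q + int a)) (int a - 1) else 0)"
proof -
  let ?m = "nat (p + q + int a)"
  have m: "nat (p + q + int a + 1) = Suc ?m" "nat (p - 1 + q + int a + 1) = ?m"
    "nat (p + (q - 1) + int a + 1) = ?m"
    using assms by auto
  show ?thesis
    unfolding strip_count_def m Let_def
    using binom_sum_step[of ?m "int a - 1"]
    by (simp add: binom_Suc binom_sum_Suc)
qed

section \<open>Solving the recursion\<close>

locale subdivision_count =
  fixes a b c :: nat and N :: "nat \<Rightarrow> nat \<Rightarrow> nat" and F :: "nat \<times> nat \<times> nat \<Rightarrow> bool" and full :: bool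
  assumes unit: "N x (Suc x) = 1"
    and rec: "\<lbrakk>Suc i < j; j \<le> a + b + c + 2; chord a c i j \<or> i = 0 \<and> j = a + b + c + 2\<rbrakk> \<Longrightarrow>
      N i j = (\<Sum>k | i < k \<and> k < j \<and> chord a c i k \<and> chord a c k j \<and> F (i, k, j). N i k * N k j)"
    and allowed: "F t \<longleftrightarrow> full \<or> \<not> central a c t"
begin

text \<open>The last assumption rules out side CA itself as outer edge, unless \<open>b = 0\<close>,
  when CA is the closing edge and the whole triangle is the corner region.\<close>

lemma count_corner_B:
  assumes "i < Suc c" "Suc c < j" "j \<le> a + c + 2" "0 < i \<or> j < a + c + 2 \<or> b = 0"
  shows "N i j = ((c - i) + (j - c - 2) choose (c - i))"
proof -
  have "N i j = ((Suc c - 1 - i) + (j - 1 - Suc c) choose (Suc c - 1 - i))"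
  proof (rule lattice_path_recursion[of i "Suc c" j N "chord a c" F])
    fix x y assume xy: "i \<le> x" "x < Suc c" "Suc c < y" "y \<le> j"
    show "N x y = (\<Sum>k | x < k \<and> k < y \<and> chord a c x k \<and> chord a c k y \<and> F (x, k, y). N x k * N k y)"
      by (rule rec) (use xy assms in \<open>auto simp: chord_def same_side_def\<close>)
  qed (use assms unit in \<open>auto simp: chord_def same_side_def allowed central_def\<close>)
  then show ?thesis by simp
qed

lemma count_corner_C:
  assumes "Suc c \<le> i" "i < a + c + 2" "a + c + 2 < j" "j \<le> a + b + c + 2"
  shows "N i j = ((a + c + 1 - i) + (j - (a + c + 3)) choose (a + c + 1 - i))"
proof -
  have "N i j = ((a + c + 2 - 1 - i) + (j - 1 - (a + c + 2)) choose (a + c + 2 - 1 - i))"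
  proof (rule lattice_path_recursion[of i "a + c + 2" j N "chord a c" F])
    fix x y assume xy: "i \<le> x" "x < a + c + 2" "a + c + 2 < y" "y \<le> j"
    show "N x y = (\<Sum>k | x < k \<and> k < y \<and> chord a c x k \<and> chord a c k y \<and> F (x, k, y). N x k * N k y)"
      by (rule rec) (use xy assms in \<open>auto simp: chord_def same_side_def\<close>)
  qed (use assms unit in \<open>auto simp: chord_def same_side_def allowed central_def\<close>)
  moreover have "a + c + 2 - 1 - i = a + c + 1 - i" "j - 1 - (a + c + 2) = j - (a + c + 3)" by auto
  ultimately show ?thesis by (simp only:)
qed

text \<open>An apex inside BC leaves one region at B and one at C, both counted by lattice paths.
  The case \<open>i = 0\<close> is included: it gives the triangles at A with apex inside BC, which
  are not central.\<close>

lemma sum_across_BC: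
  assumes i: "i < Suc c" and j: "a + c + 2 < j" "j \<le> a + b + c + 2"
  shows "int (\<Sum>k\<in>{Suc c<..<a + c + 2}. N i k * N k j)
    = binom ((c - i) + (j - (a + c + 3)) + a) (int a - 1)"
proof -
  let ?p = "c - i" and ?q = "j - (a + c + 3)"
  have "(\<Sum>k\<in>{Suc c<..<a + c + 2}. N i k * N k j)
      = (\<Sum>x<a. N i (c + 2 + x) * N (c + 2 + x) j)"
  proof -
    have "{Suc c<..<a + c + 2} = {c + 2..<a + c + 2}" by auto
    then show ?thesis
      using sum.atLeastLessThan_shift_0[of "\<lambda>k. N i k * N k j" "c + 2" "a + c + 2"]
      by (simp add: lessThan_atLeast0)
  qed
  also have "\<dots> = (\<Sum>x<a. (?p + x choose ?p) * ((a - 1 - x) + ?q choose ?q))"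
  proof (intro sum.cong refl)
    fix x assume x: "x \<in> {..<a}"
    have "N i (c + 2 + x) = (?p + x choose ?p)"
      using count_corner_B[of i "c + 2 + x"] x i by simp
    moreover have "N (c + 2 + x) j = ((a - 1 - x) + ?q choose (a - 1 - x))"
    proof -
      have e: "a + c + 1 - (c + 2 + x) = a - 1 - x" using x by auto
      show ?thesis using count_corner_C[of "c + 2 + x" j, unfolded e] x j by simp
    qed
    moreover have "((a - 1 - x) + ?q choose (a - 1 - x)) = ((a - 1 - x) + ?q choose ?q)"
      using binomial_symmetric[of "a - 1 - x" "(a - 1 - x) + ?q"] by simp
    ultimately show "N i (c + 2 + x) * N (c + 2 + x) j = (?p + x choose ?p) * ((a - 1 - x) + ?q choose ?q)"
      by simp
  qed
  also have "\<dots> = (?p + ?q + a choose (?p + ?q + 1))" by (rule sum_choose_convolution)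
  finally have "int (\<Sum>k\<in>{Suc c<..<a + c + 2}. N i k * N k j) = binom (?p + ?q + a) (int (?p + ?q + 1))"
    by (simp only: binom_of_nat)
  \<comment> \<open>Symmetry makes the lower index independent of the ends of the chord.\<close>
  also have "\<dots> = binom (?p + ?q + a) (int a - 1)"
    using binom_symmetric[of "?p + ?q + a" "int a - 1"] by (simp add: ac_simps)
  finally show ?thesis .
qed

text \<open>Induction on the length of the index range. The last assumption excludes BC itself; a
  chord ending in B or C is a corner region and starts the induction.\<close>

lemma count_strip:
  assumes "0 < i" "i \<le> Suc c" "a + c + 2 \<le> j" "j \<le> a + b + c + 2" "i < Suc c \<or> a + c + 2 < j"
  shows "int (N i j) = strip_count full a (int c - int i) (int j - int (a + c + 3))"
  using assms
proof (induction "j - i" arbitrary: i j rule: less_induct)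
  case less
  consider "i = Suc c" | "i < Suc c" "j = a + c + 2" | "i < Suc c" "a + c + 2 < j"
    using less.prems by linarith
  then show ?case
  proof cases
    case 1
    define q where "q = j - (a + c + 3)"
    have q: "int j - int (a + c + 3) = int q" "j = q + (a + c + 3)"
      using less.prems 1 unfolding q_def by auto
    have e: "a + c + 1 - Suc c = a" by simp
    have "N i j = (a + q choose a)"
      using count_corner_C[of i j] less.prems 1 unfolding 1 e q_def by simp
    also have "\<dots> = (a + q choose q)" using binomial_symmetric[of a "a + q"] by simp
    finally show ?thesis
      unfolding q(1) using strip_count_boundary[of "int q" full a] 1 by (simp flip: of_nat_add)
  next
    case 2
    define p where "p = c - i"
    have p: "int c - int i = int p" using 2 unfolding p_def by simp
    have "N i j = (p + a choose p)"
      using count_corner_B[of i j] less.prems 2 unfolding p_def by simp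
    moreover have "int j - int (a + c + 3) = -1" using 2 by simp
    ultimately show ?thesis
      unfolding p using strip_count_boundary[of "int p" full a] strip_count_commute[of full a "int p"]
      by (simp add: add.commute flip: of_nat_add)
  next
    case 3
    let ?S = "{k. i < k \<and> k < j \<and> chord a c i k \<and> chord a c k j \<and> F (i, k, j)}"
    define p q where "p = c - i" and "q = j - (a + c + 3)"
    have pq: "int c - int i = int p" "int j - int (a + c + 3) = int q"
      using 3 unfolding p_def q_def by auto
    \<comment> \<open>An apex on AB or CA, corners included, must be next to an end of the chord.
      The apexes inside BC are those of the central triangles, present only in the full
      count.\<close>
    have S: "?S = {Suc i, j - 1} \<union> (if full then {Suc c<..<a + c + 2} else {})"
      using 3 less.prems by (auto simp: chord_def same_side_def allowed central_def)
    have "N i j = (\<Sum>k\<in>?S. N i k * N k j)"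
      using 3 less.prems by (intro rec) (auto simp: chord_def same_side_def)
    also have "\<dots> = N i (Suc i) * N (Suc i) j + N i (j - 1) * N (j - 1) j
        + (if full then \<Sum>k\<in>{Suc c<..<a + c + 2}. N i k * N k j else 0)"
      unfolding S using 3 by (subst sum.union_disjoint) auto
    also have "N i (Suc i) = 1" by (rule unit)
    also have "N (j - 1) j = 1" using unit[of "j - 1"] 3 by simp
    finally have "int (N i j) = int (N (Suc i) j) + int (N i (j - 1))
        + (if full then binom (p + q + a) (int a - 1) else 0)"
      using sum_across_BC[of i j] 3 less.prems unfolding p_def q_def by simp
    moreover have "int (N (Suc i) j) = strip_count full a (int p - 1) (int q)"
    proof -
      have e: "int p - 1 = int c - int (Suc i)" using pq by simp
      show ?thesis
        unfolding e pq(2)[symmetric] by (rule less.hyps) (use 3 less.prems in auto)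
    qed
    moreover have "int (N i (j - 1)) = strip_count full a (int p) (int q - 1)"
    proof -
      have e: "int q - 1 = int (j - 1) - int (a + c + 3)" using pq 3 by simp
      show ?thesis
        unfolding e pq(1)[symmetric] by (rule less.hyps) (use 3 less.prems in auto)
    qed
    moreover have "nat (int p + int q + int a) = p + q + a" by simp
    ultimately show ?thesis
      unfolding pq using strip_count_rec[of "int p" "int q" full a] by (simp only: of_nat_0_le_iff)
  qed
qed

text \<open>For \<open>b = 0\<close> the closing edge is all of CA and B is the only corner to go
  around. Otherwise it is the edge of CA next to A, and its triangle leaves a strip or two corner
  regions.\<close>

theorem count_total:
  assumes "s = a + b + c" "0 < s"
  shows "int (N 0 (s + 2)) = (if full
    then 2 ^ (s - 1) - binom_sum (s - 1) (int a - 2) - binom_sum (s - 1) (int b - 2) - binom_sum (s - 1) (int c - 2)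
    else binom (s - 1) (int a - 1) + binom (s - 1) (int b - 1) + binom (s - 1) (int c - 1))"
proof (cases "b = 0")
  case True
  obtain m where m: "s = Suc m" using assms(2) gr0_implies_Suc by blast
  have am: "int a - 1 = int m - int c" using assms m True by simp
  have "N 0 (s + 2) = (s choose c)"
    using count_corner_B[of 0 "s + 2"] True assms by (simp add: add.commute)
  then have N: "int (N 0 (s + 2)) = binom m (int c) + binom m (int c - 1)"
    unfolding binom_of_nat[symmetric] m binom_Suc[symmetric] by simp
  have "binom m (int c) = binom m (int a - 1)"
    unfolding am by (rule binom_symmetric)
  moreover have "binom m (int c) + binom m (int c - 1) = 2 ^ m - binom_sum m (int a - 2) - binom_sum m (int c - 2)"
  proof -
    have "int m - 1 - (int a - 2) = int c" using am by simp
    then have "binom_sum m (int a - 2) + binom_sum m (int c) = 2 ^ m"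
      using binom_sum_complement[of m "int a - 2"] by simp
    then show ?thesis using binom_sum_step[of m "int c"] binom_sum_step[of m "int c - 1"] by simp
  qed
  ultimately show ?thesis using N True m by simp
next
  case False
  let ?n = "a + b + c + 2"
  let ?S = "{k. 0 < k \<and> k < ?n \<and> chord a c 0 k \<and> chord a c k ?n \<and> F (0, k, ?n)}"
  \<comment> \<open>Apex 1 gives the ear at A; an apex inside BC gives a corner-side diagonal from
    A. None of these triangles is central, so both counts share this set.\<close>
  have S: "?S = {1} \<union> {Suc c<..<a + c + 2}"
    using False by (auto simp: chord_def same_side_def allowed central_def)
  have "N 0 ?n = (\<Sum>k\<in>?S. N 0 k * N k ?n)"
    using rec[of 0 ?n] by simp
  also have "\<dots> = N 0 1 * N 1 ?n + (\<Sum>k\<in>{Suc c<..<a + c + 2}. N 0 k * N k ?n)"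
    unfolding S by (subst sum.union_disjoint) auto
  also have "N 0 1 = 1" using unit[of 0] by simp
  finally have "int (N 0 ?n) = int (N 1 ?n) + binom (c + (?n - (a + c + 3)) + a) (int a - 1)"
    using sum_across_BC[of 0 ?n] False by simp
  also have "int (N 1 ?n) = strip_count full a (int c - 1) (int ?n - int (a + c + 3))"
    using count_strip[of 1 ?n] False by simp
  also have "int ?n - int (a + c + 3) = int b - 1" by simp
  also have "c + (?n - (a + c + 3)) + a = s - 1" using False assms by simp
  finally have N: "int (N 0 (s + 2)) = strip_count full a (int c - 1) (int b - 1) + binom (s - 1) (int a - 1)"
    using assms by simp
  \<comment> \<open>Removing the ear at A leaves \<open>c - 1\<close> and \<open>b - 1\<close>
    points beside the chord. In the full count the added coefficient lowers the limit
    \<open>a - 1\<close> to \<open>a - 2\<close>.\<close>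
  have "nat (int c - 1 + (int b - 1) + int a + 1) = s - 1" using assms by simp
  then show ?thesis
    unfolding N strip_count_def Let_def using binom_sum_step[of "s - 1" "int a - 1"] by simp
qed

end

section \<open>Parametrization of the boundary\<close>

definition coordB :: "real \<Rightarrow> real" where
  "coordB t = (if t \<le> 1 then t else if t \<le> 2 then 2 - t else 0)"

definition coordC :: "real \<Rightarrow> real" where
  "coordC t = (if t \<le> 1 then 0 else if t \<le> 2 then t - 1 else 3 - t)"

text \<open>The closed curve through A, B, C at the parameters 0, 1, 2 and back to A at 3,
  in barycentric coordinates.\<close>

definition boundary :: "real^2 \<Rightarrow> real^2 \<Rightarrow> real^2 \<Rightarrow> real \<Rightarrow> real^2" where
  "boundary A B C t = A + coordB t *\<^sub>R (B - A) + coordC t *\<^sub>R (C - A)"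

text \<open>The parameter 3 is allowed as an end, so that A counts as a point of CA too.\<close>

definition on_side :: "real \<Rightarrow> real \<Rightarrow> bool" where
  "on_side s t \<longleftrightarrow> 0 \<le> s \<and> t \<le> 1 \<or> 1 \<le> s \<and> t \<le> 2 \<or> 2 \<le> s \<and> t \<le> 3"

lemma boundary_corner [simp]:
  "boundary A B C 0 = A" "boundary A B C 1 = B" "boundary A B C 2 = C" "boundary A B C 3 = A"
  by (simp_all add: boundary_def coordB_def coordC_def)

lemma orient_boundary:
  "orient (boundary A B C s) (boundary A B C t) (boundary A B C u) = orient A B C *
    ((coordB t - coordB s) * (coordC u - coordC s) - (coordC t - coordC s) * (coordB u - coordB s))"
  by (simp add: boundary_def orient_def algebra_simps)

text \<open>\<open>d\<close> is the signed area of the three points relative to ABC. It is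
  polynomial for each distribution of the points over the sides and factors into signed differences.
  The exception with \<open>s = 0\<close> is A together with two points of CA.\<close>

lemma boundary_det:
  assumes "0 \<le> s" "s < t" "t < u" "u < 3"
  defines "d \<equiv> (coordB t - coordB s) * (coordC u - coordC s) - (coordC t - coordC s) * (coordB u - coordB s)"
  shows "0 \<le> d"
    and "\<not> (u \<le> 1 \<or> 1 \<le> s \<and> u \<le> 2 \<or> 2 \<le> s \<or> s = 0 \<and> 2 \<le> t) \<Longrightarrow> 0 < d"
proof -
  let ?flat = "u \<le> 1 \<or> 1 \<le> s \<and> u \<le> 2 \<or> 2 \<le> s \<or> s = 0 \<and> 2 \<le> t"
  have "0 \<le> d \<and> (\<not> ?flat \<longrightarrow> 0 < d)"
  proof -
    \<comment> \<open>The digits of a case name give the sides of \<open>s\<close>,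
      \<open>t\<close>, \<open>u\<close>, with 1, 2, 3 for AB, BC, CA.\<close>
    consider (AB) "u \<le> 1" | (BC) "1 \<le> s" "u \<le> 2" "1 < u" | (CA) "2 \<le> s"
      | (112) "t \<le> 1" "1 < u" "u \<le> 2" | (113) "t \<le> 1" "2 < u"
      | (122) "s < 1" "1 < t" "u \<le> 2" | (123) "s \<le> 1" "1 < t" "t \<le> 2" "2 < u"
      | (133) "s \<le> 1" "2 < t" | (223) "1 < s" "t \<le> 2" "2 < u"
      | (233) "1 < s" "s < 2" "2 < t"
      by linarith
    then show ?thesis
    proof cases
      case AB
      then have "d = 0" using assms by (simp add: d_def coordB_def coordC_def)
      then show ?thesis using AB by simp
    next
      case BC
      then have "d = 0" using assms by (simp add: d_def coordB_def coordC_def algebra_simps)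
      then show ?thesis using BC by simp
    next
      case CA
      then have "d = 0" using assms by (simp add: d_def coordB_def coordC_def)
      then show ?thesis using CA by simp
    next
      case 112
      then have "d = (t - s) * (u - 1)" using assms by (simp add: d_def coordB_def coordC_def algebra_simps)
      then show ?thesis using 112 assms by simp
    next
      case 113
      then have "d = (t - s) * (3 - u)" using assms by (simp add: d_def coordB_def coordC_def algebra_simps)
      then show ?thesis using 113 assms by simp
    next
      case 122
      then have "d = (u - t) * (1 - s)" using assms by (simp add: d_def coordB_def coordC_def algebra_simps)
      then show ?thesis using 122 assms by simp
    next
      case 123
      \<comment> \<open>One point on each side is the only case with two products; the second is
        positive as soon as \<open>s > 0\<close>, and for \<open>s = 0\<close> the first
        decides.\<close>
      then have d: "d = (1 - s) * (2 - t) * (3 - u) + s * (t - 1) * (u - 2)"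
        using assms by (simp add: d_def coordB_def coordC_def algebra_simps)
      have n: "0 \<le> (1 - s) * (2 - t) * (3 - u)" "0 \<le> s * (t - 1) * (u - 2)" using 123 assms by simp_all
      show ?thesis
      proof (cases "s = 0")
        case True
        then have "d = (2 - t) * (3 - u)" using d by simp
        then show ?thesis using True 123 assms by auto
      next
        case False
        then have "0 < s * (t - 1) * (u - 2)" using 123 assms by simp
        then show ?thesis using d n by simp
      qed
    next
      case 133
      then have "d = s * (u - t)" using assms by (simp add: d_def coordB_def coordC_def algebra_simps)
      then show ?thesis using 133 assms by auto
    next
      case 223
      then have "d = (t - s) * (u - 2)" using assms by (simp add: d_def coordB_def coordC_def algebra_simps)
      then show ?thesis using 223 assms by simp
    next
      case 233
      then have "d = (2 - s) * (u - t)" using assms by (simp add: d_def coordB_def coordC_def algebra_simps)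
      then show ?thesis using 233 assms by simp
    qed
  qed
  then show "0 \<le> d" "\<not> ?flat \<Longrightarrow> 0 < d" by auto
qed

text \<open>Orientations against AB and CA read off the weights of C and B, and on one turn of the
  curve these weights determine the parameter.\<close>

lemma boundary_inj:
  assumes o: "orient A B C \<noteq> 0" and st: "s \<in> {0..<3}" "t \<in> {0..<3}"
    and eq: "boundary A B C s = boundary A B C t"
  shows "s = t"
proof -
  have "orient A B (boundary A B C x) = coordC x * orient A B C" for x
    by (simp add: boundary_def orient_def algebra_simps)
  then have C: "coordC s = coordC t" using eq o by (metis mult_cancel_right)
  have "orient C A (boundary A B C x) = coordB x * orient A B C" for x
    by (simp add: boundary_def orient_def algebra_simps)
  then have "coordB s = coordB t" using eq o by (metis mult_cancel_right)
  then show ?thesis using C st by (auto simp: coordB_def coordC_def split: if_splits)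
qed

lemma boundary_affine:
  assumes "on_side s t" "s \<le> t" "0 \<le> l" "l \<le> 1"
  shows "boundary A B C ((1 - l) * s + l * t) = (1 - l) *\<^sub>R boundary A B C s + l *\<^sub>R boundary A B C t"
proof -
  define x where "x = (1 - l) * s + l * t"
  have "l * s \<le> l * t" "(1 - l) * s \<le> (1 - l) * t" using assms by (auto intro: mult_left_mono)
  then have x: "s \<le> x" "x \<le> t" unfolding x_def by (auto simp: algebra_simps)
  have "coordB x = (1 - l) * coordB s + l * coordB t \<and> coordC x = (1 - l) * coordC s + l * coordC t"
  proof -
    consider "0 \<le> s" "t \<le> 1" | "1 \<le> s" "t \<le> 2" | "2 \<le> s" "t \<le> 3"
      using assms by (auto simp: on_side_def)
    then show ?thesis
    proof cases
      case 1
      then have y: "coordB y = y" "coordC y = 0" if "s \<le> y" "y \<le> t" for y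
        using that by (auto simp: coordB_def coordC_def)
      show ?thesis
        unfolding y[OF x] y[OF order_refl assms(2)] y[OF assms(2) order_refl]
        by (simp add: x_def algebra_simps)
    next
      case 2
      then have y: "coordB y = 2 - y" "coordC y = y - 1" if "s \<le> y" "y \<le> t" for y
        using that by (auto simp: coordB_def coordC_def)
      show ?thesis
        unfolding y[OF x] y[OF order_refl assms(2)] y[OF assms(2) order_refl]
        by (simp add: x_def algebra_simps)
    next
      case 3
      then have y: "coordB y = 0" "coordC y = 3 - y" if "s \<le> y" "y \<le> t" for y
        using that by (auto simp: coordB_def coordC_def)
      show ?thesis
        unfolding y[OF x] y[OF order_refl assms(2)] y[OF assms(2) order_refl]
        by (simp add: x_def algebra_simps)
    qed
  qed
  then have "coordB x = (1 - l) * coordB s + l * coordB t" "coordC x = (1 - l) * coordC s + l * coordC t"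
    by auto
  then show ?thesis
    unfolding boundary_def x_def[symmetric] by (simp only:) (simp add: algebra_simps)
qed

lemma open_segment_boundary:
  assumes o: "orient A B C \<noteq> 0" and st: "on_side s t" "s < t"
  shows "open_segment (boundary A B C s) (boundary A B C t) = boundary A B C ` {s<..<t}"
proof -
  let ?b = "boundary A B C"
  have "?b s \<noteq> ?b t"
  proof
    assume eq: "?b s = ?b t"
    have s: "s \<in> {0..<3}" using st by (auto simp: on_side_def)
    show False
    proof (cases "t = 3")
      case True
      \<comment> \<open>Parameter 3 is outside the range of injectivity and is replaced by 0, the
        same point.\<close>
      then have "?b s = ?b 0" using eq by simp
      then have "s = 0" using boundary_inj[OF o s] by simp
      then show False using st True by (auto simp: on_side_def)
    next
      case False
      then have "t \<in> {0..<3}" using st by (auto simp: on_side_def)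
      then show False using boundary_inj[OF o s _ eq] st by simp
    qed
  qed
  then have seg: "open_segment (?b s) (?b t) = {(1 - l) *\<^sub>R ?b s + l *\<^sub>R ?b t | l. 0 < l \<and> l < 1}"
    by (auto simp: in_segment)
  also have "\<dots> = ?b ` {(1 - l) * s + l * t | l. 0 < l \<and> l < 1}"
    unfolding setcompr_eq_image image_image
    by (intro image_cong refl) (use boundary_affine[OF st(1)] st(2) in simp)
  also have "{(1 - l) * s + l * t | l. 0 < l \<and> l < 1} = {s<..<t}"
  proof (intro equalityI subsetI)
    fix x assume x: "x \<in> {s<..<t}"
    define l where "l = (x - s) / (t - s)"
    have "l * (t - s) = x - s" using st(2) by (simp add: l_def)
    then have "x = (1 - l) * s + l * t" by (simp add: algebra_simps)
    moreover have "0 < l" "l < 1" using x st(2) by (simp_all add: l_def)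
    ultimately show "x \<in> {(1 - l) * s + l * t | l. 0 < l \<and> l < 1}" by blast
  next
    fix x assume "x \<in> {(1 - l) * s + l * t | l. 0 < l \<and> l < 1}"
    then obtain l where l: "x = (1 - l) * s + l * t" "0 < l" "l < 1" by blast
    then have "l * s < l * t" "(1 - l) * s < (1 - l) * t" using st(2) by simp_all
    then show "x \<in> {s<..<t}" unfolding l(1) by (simp add: algebra_simps)
  qed
  finally show ?thesis .
qed

section \<open>Numbering the points along the boundary\<close>

text \<open>The last clause finds the number of a given element by counting the smaller ones; this
  is how the corners get their indices.\<close>

lemma strict_mono_enumeration:
  fixes U :: "real set"
  assumes "finite U"
  obtains \<tau> where "strict_mono_on {..<card U} \<tau>" "\<tau> ` {..<card U} = U"
    "\<And>i. i < card U \<Longrightarrow> i = card {x \<in> U. x < \<tau> i}"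
proof -
  obtain xs where xs: "sorted_wrt (<) xs" "set xs = U" "length xs = card U"
    using finite_set_strict_sorted[OF assms] by blast
  define \<tau> where "\<tau> i = xs ! i" for i
  have mono: "\<tau> i < \<tau> j" if "i < j" "j < card U" for i j
    unfolding \<tau>_def using sorted_wrt_nth_less[OF xs(1)] that xs(3) by simp
  have img: "\<tau> ` {..<card U} = U"
    unfolding \<tau>_def xs(3)[symmetric] using xs(2) by (auto simp: set_conv_nth)
  have "i = card {x \<in> U. x < \<tau> i}" if i: "i < card U" for i
  proof -
    have "{x \<in> U. x < \<tau> i} = \<tau> ` {..<i}"
    proof (intro equalityI subsetI)
      fix x assume "x \<in> {x \<in> U. x < \<tau> i}"
      then obtain j where j: "j < card U" "x = \<tau> j" "\<tau> j < \<tau> i" using img by auto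
      then have "j < i" using mono[of i j] by (metis linorder_neqE_nat order_less_asym less_irrefl)
      then show "x \<in> \<tau> ` {..<i}" using j by simp
    qed (use mono i img in auto)
    moreover have "inj_on \<tau> {..<i}"
    proof (rule inj_onI)
      fix x y assume "x \<in> {..<i}" "y \<in> {..<i}" "\<tau> x = \<tau> y"
      then show "x = y" using mono[of x y] mono[of y x] i by (cases x y rule: linorder_cases) fastforce+
    qed
    ultimately show ?thesis by (simp add: card_image)
  qed
  then show ?thesis using that[of \<tau>] mono img by (auto simp: strict_mono_on_def)
qed

text \<open>Sort the parameters of the points within one turn. Below parameter 1 lie A and
  \<open>c\<close> points, below 2 also B and \<open>a\<close> points, which fixes the numbers of B
  and C.\<close>

lemma subdivided_triangle_parametrization:
  assumes sub: "subdivided_triangle a b c A B C P" and n: "n = a + b + c + 2"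
  obtains \<tau> where "\<And>i j. \<lbrakk>i \<le> n; j \<le> n\<rbrakk> \<Longrightarrow> \<tau> i < \<tau> j \<longleftrightarrow> i < j"
    "\<And>i. i \<le> n \<Longrightarrow> \<tau> i \<in> {0..<3}"
    "\<tau> 0 = 0" "\<tau> (Suc c) = 1" "\<tau> (a + c + 2) = 2"
    "P = (\<lambda>i. boundary A B C (\<tau> i)) ` {..n}"
proof -
  let ?b = "boundary A B C"
  have o: "orient A B C \<noteq> 0"
    using sub orient_eq_0_iff_collinear by (auto simp: subdivided_triangle_def)
  have P: "finite P" "A \<in> P" "B \<in> P" "C \<in> P"
    "P \<subseteq> closed_segment B C \<union> closed_segment C A \<union> closed_segment A B"
    and cards: "card (P \<inter> open_segment B C) = a" "card (P \<inter> open_segment C A) = b"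
      "card (P \<inter> open_segment A B) = c"
    using sub by (auto simp: subdivided_triangle_def)
  have seg: "open_segment A B = ?b ` {0<..<1}" "open_segment B C = ?b ` {1<..<2}"
    "open_segment C A = ?b ` {2<..<3}"
    using open_segment_boundary[OF o, of 0 1] open_segment_boundary[OF o, of 1 2]
      open_segment_boundary[OF o, of 2 3] by (simp_all add: on_side_def)
  define U where "U = {t \<in> {0..<3}. ?b t \<in> P}"
  have inj: "inj_on ?b {0..<3}" using boundary_inj[OF o] by (intro inj_onI) auto
  have "P \<subseteq> ?b ` {0..<3}"
  proof
    fix x assume "x \<in> P"
    then have "x \<in> {A, B, C} \<union> open_segment A B \<union> open_segment B C \<union> open_segment C A"
      using P(5) unfolding closed_segment_eq_open by blast
    moreover have "?b ` I \<subseteq> ?b ` {0..<3}" if "I \<subseteq> {0..<3}" for I using that by (rule image_mono)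
    from this[of "{0<..<1}"] this[of "{1<..<2}"] this[of "{2<..<3}"]
    have "open_segment A B \<subseteq> ?b ` {0..<3}" "open_segment B C \<subseteq> ?b ` {0..<3}"
      "open_segment C A \<subseteq> ?b ` {0..<3}"
      unfolding seg by auto
    moreover have "A \<in> ?b ` {0..<3}" "B \<in> ?b ` {0..<3}" "C \<in> ?b ` {0..<3}"
      using image_eqI[of A ?b 0 "{0..<3}"] image_eqI[of B ?b 1 "{0..<3}"]
        image_eqI[of C ?b 2 "{0..<3}"] by simp_all
    ultimately show "x \<in> ?b ` {0..<3}" by blast
  qed
  then have PU: "P = ?b ` U" unfolding U_def by auto
  have injU: "inj_on ?b U" by (rule inj_on_subset[OF inj]) (auto simp: U_def)
  then have finU: "finite U" using P(1) unfolding PU by (rule finite_imageD[rotated])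
  have inU: "0 \<in> U" "1 \<in> U" "2 \<in> U" using P by (simp_all add: U_def)
  have part: "card (U \<inter> {l<..<r}) = card (P \<inter> ?b ` {l<..<r})" if "0 \<le> l" "r \<le> 3" for l r
  proof -
    have "P \<inter> ?b ` {l<..<r} = ?b ` (U \<inter> {l<..<r})"
      using that by (auto simp: U_def)
    moreover have "inj_on ?b (U \<inter> {l<..<r})" using injU by (rule inj_on_subset) auto
    ultimately show ?thesis by (simp add: card_image)
  qed
  have cardU: "card (U \<inter> {0<..<1}) = c" "card (U \<inter> {1<..<2}) = a" "card (U \<inter> {2<..<3}) = b"
    using part[of 0 1] part[of 1 2] part[of 2 3] cards unfolding seg by simp_all
  have below1: "{x \<in> U. x < 1} = insert 0 (U \<inter> {0<..<1})"
    using inU by (auto simp: U_def)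
  have c1: "card {x \<in> U. x < 1} = Suc c" unfolding below1 using cardU finU by simp
  have below2: "{x \<in> U. x < 2} = {x \<in> U. x < 1} \<union> insert 1 (U \<inter> {1<..<2})"
    using inU by auto
  have c2: "card {x \<in> U. x < 2} = a + c + 2"
    unfolding below2 using cardU finU c1 by (subst card_Un_disjoint) auto
  have U: "U = {x \<in> U. x < 2} \<union> insert 2 (U \<inter> {2<..<3})"
    using inU by (auto simp: U_def)
  have "card ({x \<in> U. x < 2} \<union> insert 2 (U \<inter> {2<..<3})) = Suc n"
    using cardU finU c2 n by (subst card_Un_disjoint) auto
  then have cU: "card U = Suc n" using U by simp
  obtain \<tau> where \<tau>: "strict_mono_on {..<card U} \<tau>" "\<tau> ` {..<card U} = U"
    "\<And>i. i < card U \<Longrightarrow> i = card {x \<in> U. x < \<tau> i}"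
    using strict_mono_enumeration[OF finU] by blast
  have pos: "\<tau> (card {x \<in> U. x < u}) = u" if "u \<in> U" for u
  proof -
    have "u \<in> \<tau> ` {..<card U}" using \<open>u \<in> U\<close> unfolding \<tau>(2) .
    then obtain i where i: "i < card U" "u = \<tau> i" by blast
    show ?thesis unfolding i(2) \<tau>(3)[OF i(1), symmetric] ..
  qed
  have c0: "{x \<in> U. x < 0} = {}" by (auto simp: U_def)
  show ?thesis
  proof (rule that[of \<tau>])
    have lt: "{..<card U} = {..n}" using cU by auto
    show "\<tau> i < \<tau> j \<longleftrightarrow> i < j" if "i \<le> n" "j \<le> n" for i j
      using strict_mono_on_less[OF \<tau>(1), of i j] that unfolding lt by simp
    have img: "\<tau> ` {..n} = U" using \<tau>(2) unfolding lt .
    have "\<tau> i \<in> U" if "i \<le> n" for i unfolding img[symmetric] using that by blast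
    then show "\<tau> i \<in> {0..<3}" if "i \<le> n" for i using that by (auto simp: U_def)
    show "\<tau> 0 = 0" using pos[OF inU(1)] unfolding c0 by simp
    show "\<tau> (Suc c) = 1" using pos[OF inU(2)] unfolding c1 .
    show "\<tau> (a + c + 2) = 2" using pos[OF inU(3)] unfolding c2 .
    show "P = (\<lambda>i. ?b (\<tau> i)) ` {..n}" using PU unfolding img[symmetric] by (simp only: image_image)
  qed
qed

section \<open>The subdivided triangle as a degenerate polygon\<close>

locale parametrized_triangle =
  fixes a b c n :: nat and A B C :: "real^2" and \<tau> :: "nat \<Rightarrow> real"
  assumes n: "n = a + b + c + 2" and o: "orient A B C \<noteq> 0"
    and mono: "\<lbrakk>i \<le> n; j \<le> n\<rbrakk> \<Longrightarrow> \<tau> i < \<tau> j \<longleftrightarrow> i < j"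
    and range: "i \<le> n \<Longrightarrow> \<tau> i \<in> {0..<3}"
    and corner: "\<tau> 0 = 0" "\<tau> (Suc c) = 1" "\<tau> (a + c + 2) = 2"
begin

definition pt :: "nat \<Rightarrow> real^2" where "pt i = boundary A B C (\<tau> i)"

lemma param_le: "\<lbrakk>i \<le> n; j \<le> n\<rbrakk> \<Longrightarrow> \<tau> i \<le> \<tau> j \<longleftrightarrow> i \<le> j"
  using mono[of j i] by (simp add: not_less[symmetric])

lemma param_corner:
  assumes "i \<le> n"
  shows "\<tau> i \<le> 1 \<longleftrightarrow> i \<le> Suc c" "1 \<le> \<tau> i \<longleftrightarrow> Suc c \<le> i"
    "\<tau> i \<le> 2 \<longleftrightarrow> i \<le> a + c + 2" "2 \<le> \<tau> i \<longleftrightarrow> a + c + 2 \<le> i" "\<tau> i = 0 \<longleftrightarrow> i = 0"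
proof -
  have k: "Suc c \<le> n" "a + c + 2 \<le> n" using n by auto
  show "\<tau> i \<le> 1 \<longleftrightarrow> i \<le> Suc c" "1 \<le> \<tau> i \<longleftrightarrow> Suc c \<le> i"
    using param_le[OF assms k(1)] param_le[OF k(1) assms] corner by simp_all
  show "\<tau> i \<le> 2 \<longleftrightarrow> i \<le> a + c + 2" "2 \<le> \<tau> i \<longleftrightarrow> a + c + 2 \<le> i"
    using param_le[OF assms k(2)] param_le[OF k(2) assms] corner by simp_all
  show "\<tau> i = 0 \<longleftrightarrow> i = 0"
    using mono[of 0 i] assms corner(1) by (cases "i = 0") auto
qed

text \<open>The factor \<open>orient A B C\<close> occurs twice in the product, so its square makes
  the sign independent of the orientation of ABC; this is the choice of \<open>\<sigma>\<close> for
  the polygon.\<close>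

lemma orient_pt:
  assumes "i < j" "j < k" "k \<le> n"
  shows "0 \<le> orient A B C * orient (pt i) (pt j) (pt k)"
    and "\<not> (k \<le> Suc c \<or> Suc c \<le> i \<and> k \<le> a + c + 2 \<or> a + c + 2 \<le> i \<or> i = 0 \<and> a + c + 2 \<le> j) \<Longrightarrow>
      0 < orient A B C * orient (pt i) (pt j) (pt k)"
proof -
  have ijk: "0 \<le> \<tau> i" "\<tau> i < \<tau> j" "\<tau> j < \<tau> k" "\<tau> k < 3"
    using assms mono range[of i] range[of k] by auto
  have sq: "0 < orient A B C * orient A B C" using o by (simp add: zero_less_mult_iff) linarith
  show "0 \<le> orient A B C * orient (pt i) (pt j) (pt k)"
    unfolding pt_def orient_boundary mult.assoc[symmetric]
    by (rule mult_nonneg_nonneg[OF less_imp_le[OF sq] boundary_det(1)[OF ijk]])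
  assume "\<not> (k \<le> Suc c \<or> Suc c \<le> i \<and> k \<le> a + c + 2 \<or> a + c + 2 \<le> i \<or> i = 0 \<and> a + c + 2 \<le> j)"
  then have "\<not> (\<tau> k \<le> 1 \<or> 1 \<le> \<tau> i \<and> \<tau> k \<le> 2 \<or> 2 \<le> \<tau> i \<or> \<tau> i = 0 \<and> 2 \<le> \<tau> j)"
    using assms param_corner[of i] param_corner[of j] param_corner[of k] by simp
  then show "0 < orient A B C * orient (pt i) (pt j) (pt k)"
    unfolding pt_def orient_boundary mult.assoc[symmetric]
    by (rule mult_pos_pos[OF sq boundary_det(2)[OF ijk]])
qed

sublocale polygon n pt "chord a c" "orient A B C"
proof
  fix i j k assume "i < j" "j < k" "k \<le> n"
  then show "0 \<le> orient A B C * orient (pt i) (pt j) (pt k)" by (rule orient_pt(1))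
next
  fix x y q assume "chord a c x y" "x < q" "q < y" "y \<le> n"
  then show "0 < orient A B C * orient (pt x) (pt q) (pt y)"
    by (intro orient_pt(2)) (auto simp: chord_def same_side_def)
next
  fix x y q assume "chord a c x y" "Suc x < y" "y \<le> n" "q < x"
  then show "0 < orient A B C * orient (pt q) (pt x) (pt y)"
    by (intro orient_pt(2)) (auto simp: chord_def same_side_def)
next
  fix x y q assume "chord a c x y" "Suc x < y" "y < q" "q \<le> n"
  then show "0 < orient A B C * orient (pt x) (pt y) (pt q)"
    by (intro orient_pt(2)) (auto simp: chord_def same_side_def)
next
  show "0 < orient A B C * orient (pt 0) (pt 1) (pt n)"
    using n by (intro orient_pt(2)) auto
qed

lemma pt_inj: "inj_on pt {..n}"
proof (rule inj_onI)
  fix i j assume ij: "i \<in> {..n}" "j \<in> {..n}" "pt i = pt j"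
  then have "\<tau> i = \<tau> j" using boundary_inj[OF o] range by (auto simp: pt_def)
  then show "i = j" using ij mono[of i j] mono[of j i] by (metis atMost_iff less_irrefl linorder_neqE_nat)
qed

lemma pt_in_segment:
  assumes m: "m \<le> n" and st: "on_side s t" "s < t"
  shows "pt m \<in> open_segment (boundary A B C s) (boundary A B C t) \<longleftrightarrow> s < \<tau> m \<and> \<tau> m < t"
proof -
  have "{s<..<t} \<subseteq> {0..<3}" using st by (auto simp: on_side_def)
  then have "pt m \<in> boundary A B C ` {s<..<t} \<longleftrightarrow> \<tau> m \<in> {s<..<t}"
    unfolding pt_def using range[OF m] boundary_inj[OF o] by blast
  then show ?thesis using open_segment_boundary[OF o st] by simp
qed

lemma pt_in_open_side:
  assumes m: "m \<le> n"
  shows "pt m \<in> open_segment A B \<longleftrightarrow> 0 < m \<and> m < Suc c"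
    "pt m \<in> open_segment B C \<longleftrightarrow> Suc c < m \<and> m < a + c + 2"
    "pt m \<in> open_segment C A \<longleftrightarrow> a + c + 2 < m"
proof -
  have r: "0 \<le> \<tau> m" "\<tau> m < 3" using range[OF m] by auto
  show "pt m \<in> open_segment A B \<longleftrightarrow> 0 < m \<and> m < Suc c"
    using pt_in_segment[OF m, of 0 1] param_corner[OF m] r by (auto simp: on_side_def)
  show "pt m \<in> open_segment B C \<longleftrightarrow> Suc c < m \<and> m < a + c + 2"
    using pt_in_segment[OF m, of 1 2] param_corner[OF m] by (auto simp: on_side_def)
  show "pt m \<in> open_segment C A \<longleftrightarrow> a + c + 2 < m"
    using pt_in_segment[OF m, of 2 3] param_corner[OF m] r by (auto simp: on_side_def)
qed

text \<open>Within one side the parameter orders the points, so empty means adjacent. Between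
  different sides the segment is always empty, since every other vertex is strictly off its
  line.\<close>

lemma empty_segment_iff:
  assumes pq: "p < q" "q \<le> n"
  shows "pt ` {..n} \<inter> open_segment (pt p) (pt q) = {} \<longleftrightarrow> base p q"
proof -
  have pn: "p \<le> n" using pq by simp
  have tpq: "\<tau> p < \<tau> q" using mono pq by simp
  consider (side) "on_side (\<tau> p) (\<tau> q)" | (last) "p = 0" "a + c + 2 \<le> q" | (cross) "\<not> same_side a c p q"
    using param_corner[OF pn] param_corner[OF pq(2)] range[OF pn] range[OF pq(2)]
    by (auto simp: same_side_def on_side_def)
  then show ?thesis
  proof cases
    case side
    have "pt r \<in> open_segment (pt p) (pt q) \<longleftrightarrow> p < r \<and> r < q" if "r \<le> n" for r
      using pt_in_segment[OF that side tpq] mono that pn pq unfolding pt_def by simp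
    then have "pt ` {..n} \<inter> open_segment (pt p) (pt q) = {} \<longleftrightarrow> (\<forall>r\<le>n. \<not> (p < r \<and> r < q))"
      by blast
    also have "\<dots> \<longleftrightarrow> q = Suc p"
    proof
      assume "\<forall>r\<le>n. \<not> (p < r \<and> r < q)"
      then have "\<not> (p < Suc p \<and> Suc p < q)" using pq by auto
      then show "q = Suc p" using pq by simp
    qed auto
    also have "\<dots> \<longleftrightarrow> base p q"
    proof -
      have "q \<le> Suc c \<or> Suc c \<le> p \<and> q \<le> a + c + 2 \<or> a + c + 2 \<le> p"
        using side unfolding on_side_def param_corner(1,3)[OF pq(2)] param_corner(2,4)[OF pn] by blast
      then show ?thesis
        unfolding base_def chord_def same_side_def using pq n by auto
    qed
    finally show ?thesis .
  next
    case last
    have q2: "on_side (\<tau> q) 3" "\<tau> q < 3"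
      using param_corner[OF pq(2)] last range[OF pq(2)] by (auto simp: on_side_def)
    \<comment> \<open>Seen from CA, the vertex A has parameter 3 instead of 0; the segment is then
      empty only if \<open>q\<close> is the last vertex, that is, for the closing edge.\<close>
    have "pt p = boundary A B C 3" using last corner(1) by (simp add: pt_def)
    then have os: "open_segment (pt p) (pt q) = open_segment (boundary A B C (\<tau> q)) (boundary A B C 3)"
      using open_segment_commute unfolding pt_def[of q] by metis
    have "pt r \<in> open_segment (pt p) (pt q) \<longleftrightarrow> q < r" if "r \<le> n" for r
      unfolding os pt_in_segment[OF that q2] using mono[OF pq(2) that] range[OF that] by simp
    then have "pt ` {..n} \<inter> open_segment (pt p) (pt q) = {} \<longleftrightarrow> (\<forall>r\<le>n. \<not> q < r)"
      by blast
    also have "\<dots> \<longleftrightarrow> q = n" using pq by fastforce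
    also have "\<dots> \<longleftrightarrow> base p q"
      using last pq by (auto simp: base_def chord_def same_side_def)
    finally show ?thesis .
  next
    case cross
    then have ch: "chord a c p q" "Suc p < q" using pq by (auto simp: chord_def same_side_def)
    have "pt r \<notin> open_segment (pt p) (pt q)" if "r \<le> n" for r
    proof
      assume r: "pt r \<in> open_segment (pt p) (pt q)"
      then have "r \<noteq> p" "r \<noteq> q" by (auto simp: open_segment_def)
      then consider "p < r" "r < q" | "r < p \<or> q < r" by linarith
      then have "side p q (pt r) \<noteq> 0"
      proof cases
        case 1
        then show ?thesis using side_inside_neg[of p q r] ch pq by simp
      next
        case 2
        then show ?thesis using side_outside_pos[of p q r] ch pq that by simp
      qed
      then show False using orient_open_segment[OF r] by (simp add: side_def)
    qed
    moreover have "base p q" using ch pq by (simp add: base_def)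
    ultimately show ?thesis by blast
  qed
qed

lemma hull_pt: "convex hull (pt ` {..n}) = convex hull {A, B, C}"
proof
  have "pt i \<in> convex hull {A, B, C}" if "i \<le> n" for i
  proof -
    have t: "0 \<le> \<tau> i" "\<tau> i < 3" using range[OF that] by auto
    have "pt i = (1 - coordB (\<tau> i) - coordC (\<tau> i)) *\<^sub>R A + coordB (\<tau> i) *\<^sub>R B + coordC (\<tau> i) *\<^sub>R C"
      by (simp add: pt_def boundary_def algebra_simps)
    moreover have "0 \<le> 1 - coordB (\<tau> i) - coordC (\<tau> i)" "0 \<le> coordB (\<tau> i)" "0 \<le> coordC (\<tau> i)"
      using t by (auto simp: coordB_def coordC_def)
    ultimately show ?thesis unfolding convex_hull_3 by (intro CollectI exI) auto
  qed
  then show "convex hull (pt ` {..n}) \<subseteq> convex hull {A, B, C}"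
    by (intro hull_minimal) auto
  have "pt 0 = A" "pt (Suc c) = B" "pt (a + c + 2) = C"
    unfolding pt_def corner by simp_all
  then have "{A, B, C} = pt ` {0, Suc c, a + c + 2}" by simp
  also have "\<dots> \<subseteq> pt ` {..n}" using n by (intro image_mono) auto
  finally show "convex hull {A, B, C} \<subseteq> convex hull (pt ` {..n})" by (rule hull_mono)
qed

lemma central_triangle_iff:
  assumes "admissible t"
  shows "central_triangle A B C (tri t) \<longleftrightarrow> central a c t"
proof -
  obtain p q r where t: "t = (p, q, r)" by (metis prod_cases3)
  have l: "p < q" "q < r" "r \<le> n" using assms t by (auto simp: admissible_def)
  have ext: "{x. x extreme_point_of tri t} = {pt p, pt q, pt r}"
    using extreme_points_tri assms t by simp
  show ?thesis
  proof
    assume "central_triangle A B C (tri t)"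
    then obtain x y z where xyz: "x \<in> open_segment B C" "y \<in> open_segment C A" "z \<in> open_segment A B"
      and eq: "{pt p, pt q, pt r} = {x, y, z}"
      unfolding central_triangle_def ext by blast
    have "x \<in> pt ` {p, q, r}" "y \<in> pt ` {p, q, r}" "z \<in> pt ` {p, q, r}" using eq by auto
    then obtain i j k where ijk: "x = pt i" "y = pt j" "z = pt k" "{i, j, k} \<subseteq> {p, q, r}" by blast
    have "i \<le> n" "j \<le> n" "k \<le> n" using ijk(4) l by auto
    then have "0 < k" "k < Suc c" "Suc c < i" "i < a + c + 2" "a + c + 2 < j"
      using xyz ijk(1-3) pt_in_open_side by auto
    \<comment> \<open>The sides force \<open>k < i < j\<close>, so these are \<open>p\<close>,
      \<open>q\<close>, \<open>r\<close> in this order.\<close>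
    then show "central a c t"
      using ijk(4) l by (auto simp: central_def t)
  next
    assume "central a c t"
    then have "pt q \<in> open_segment B C" "pt r \<in> open_segment C A" "pt p \<in> open_segment A B"
      using l pt_in_open_side by (auto simp: central_def t)
    moreover have "{pt p, pt q, pt r} = {pt q, pt r, pt p}" by blast
    ultimately show "central_triangle A B C (tri t)"
      unfolding central_triangle_def ext by blast
  qed
qed

lemma card_dissections_total:
  assumes "s = a + b + c" "0 < s"
  shows "int (card (dissections (\<lambda>t. full \<or> \<not> central a c t) 0 n)) = (if full
    then 2 ^ (s - 1) - binom_sum (s - 1) (int a - 2) - binom_sum (s - 1) (int b - 2) - binom_sum (s - 1) (int c - 2)
    else binom (s - 1) (int a - 1) + binom (s - 1) (int b - 1) + binom (s - 1) (int c - 1))"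
proof -
  let ?F = "\<lambda>t. full \<or> \<not> central a c t"
  interpret subdivision_count a b c "\<lambda>i j. card (dissections ?F i j)" ?F full
  proof
    show "card (dissections ?F x (Suc x)) = 1" for x by (simp add: dissections_Suc)
    fix i j
    assume ij: "Suc i < j" "j \<le> a + b + c + 2" "chord a c i j \<or> i = 0 \<and> j = a + b + c + 2"
    then have "base i j" unfolding base_def using n by auto
    then show "card (dissections ?F i j) =
      (\<Sum>k | i < k \<and> k < j \<and> chord a c i k \<and> chord a c k j \<and> ?F (i, k, j).
        card (dissections ?F i k) * card (dissections ?F k j))"
      using ij(1) by (rule card_dissections)
  qed simp
  show ?thesis using count_total[OF assms] n assms(1) by simp
qed

end

theorem theorem5p2:
  fixes a b c s :: nat and A B C :: "real^2" and P :: "(real^2) set"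
  assumes "subdivided_triangle a b c A B C P"
    and "\<not> (a = 0 \<and> b = 0 \<and> c = 0)"
    and "s = a + b + c"
  shows "(int (card (D_triangulations A B C P)) =
           binom (s - 1) (int a - 1) + binom (s - 1) (int b - 1) + binom (s - 1) (int c - 1))
         \<and> (int (card (T_triangulations A B C P)) =
           2 ^ (s - 1) - (\<Sum>l = 0..int a - 1. binom (s - 1) l)
                       - (\<Sum>l = 0..int b - 1. binom (s - 1) l)
                       - (\<Sum>l = 0..int c - 1. binom (s - 1) l))
         \<and> (int (card (triangulations A B C P)) =
           2 ^ (s - 1) - (\<Sum>l = 0..int a - 2. binom (s - 1) l)
                       - (\<Sum>l = 0..int b - 2. binom (s - 1) l)
                       - (\<Sum>l = 0..int c - 2. binom (s - 1) l))"
proof -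
  define n where "n = a + b + c + 2"
  have s: "0 < s" using assms by simp
  obtain \<tau> where \<tau>: "\<And>i j. \<lbrakk>i \<le> n; j \<le> n\<rbrakk> \<Longrightarrow> \<tau> i < \<tau> j \<longleftrightarrow> i < j"
    "\<And>i. i \<le> n \<Longrightarrow> \<tau> i \<in> {0..<3}"
    "\<tau> 0 = 0" "\<tau> (Suc c) = 1" "\<tau> (a + c + 2) = 2"
    and P: "P = (\<lambda>i. boundary A B C (\<tau> i)) ` {..n}"
    using subdivided_triangle_parametrization[OF assms(1) n_def] by metis
  interpret parametrized_triangle a b c n A B C \<tau>
    using \<tau> n_def orient_eq_0_iff_collinear assms(1)
    by unfold_locales (auto simp: subdivided_triangle_def)
  have P: "P = pt ` {..n}" unfolding P pt_def ..
  have n2: "2 \<le> n" by (simp add: n_def)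
  have "D_triangulations A B C P = {\<T> \<in> triangulations A B C (pt ` {..n}). \<forall>T\<in>\<T>. \<not> central_triangle A B C T}"
    unfolding D_triangulations_def P by blast
  \<comment> \<open>The redundant \<open>False\<close> fits the filter to the \<open>full\<close>
    switch of \<open>card_dissections_total\<close>.\<close>
  also have "card \<dots> = card (dissections (\<lambda>t. False \<or> \<not> central a c t) 0 n)"
    using central_triangle_iff by (intro card_triangulations_eq(1)[OF pt_inj n2 empty_segment_iff hull_pt]) auto
  finally have D: "int (card (D_triangulations A B C P)) =
      binom (s - 1) (int a - 1) + binom (s - 1) (int b - 1) + binom (s - 1) (int c - 1)"
    using card_dissections_total[OF assms(3) s, of False] by simp
  have all: "triangulations A B C P = {\<T> \<in> triangulations A B C (pt ` {..n}). \<forall>T\<in>\<T>. True}"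
    unfolding P by simp
  have "card (triangulations A B C P) = card (dissections (\<lambda>t. True \<or> \<not> central a c t) 0 n)"
    unfolding all by (intro card_triangulations_eq(1)[OF pt_inj n2 empty_segment_iff hull_pt]) auto
  then have total: "int (card (triangulations A B C P)) = 2 ^ (s - 1)
      - binom_sum (s - 1) (int a - 2) - binom_sum (s - 1) (int b - 2) - binom_sum (s - 1) (int c - 2)"
    using card_dissections_total[OF assms(3) s, of True] by simp
  have fin: "finite (triangulations A B C P)"
    unfolding all by (intro card_triangulations_eq(2)[OF pt_inj n2 empty_segment_iff hull_pt, where F="\<lambda>_. True"]) auto
  have "triangulations A B C P = D_triangulations A B C P \<union> T_triangulations A B C P"
    "D_triangulations A B C P \<inter> T_triangulations A B C P = {}"
    by (auto simp: D_triangulations_def T_triangulations_def)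
  then have "card (triangulations A B C P) = card (D_triangulations A B C P) + card (T_triangulations A B C P)"
    using fin by (metis card_Un_disjoint finite_Un)
  \<comment> \<open>Subtracting one coefficient per side from the total raises each upper limit by
    one, from \<open>a - 2\<close> to \<open>a - 1\<close> and likewise for \<open>b\<close> and
    \<open>c\<close>.\<close>
  then have "int (card (T_triangulations A B C P)) = 2 ^ (s - 1)
      - binom_sum (s - 1) (int a - 1) - binom_sum (s - 1) (int b - 1) - binom_sum (s - 1) (int c - 1)"
    using D total binom_sum_step[of "s - 1" "int a - 1"] binom_sum_step[of "s - 1" "int b - 1"]
      binom_sum_step[of "s - 1" "int c - 1"] by simp
  then show ?thesis using D total unfolding binom_sum_def by blast
qed

end
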